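(* Let $X_1,X_2,\ldots$ be independent mean zero random variables such that $\mathrm{Var}(X_i)=\sigma_i^2$. Let $W=\sum_{i=1}^N X_i$, where $N$ is a discrete random variable whose support is a subset of $\{0,1,2,\ldots\}$ and which is independent of all $X_i$. Define $\sigma^2:=\mathrm{Var}(W)=\sum_{i=1}^\infty\sigma_i^2P(N\ge i)$. Let $I$ be a random index with values in $\{1,2,\ldots\}$, independent of $N$ and of all $X_i$, with $P(I=i)=\sigma_i^2P(N\ge i)/\sigma^2$. Let $h:\mathbb{R}\to\mathbb{R}$ satisfy $|h(y)-h(x)|\le|y-x|$ for all $x,y$, and let $f_h$ be the solution to Stein's equation for $h$. Then $$\left|\mathbb{E}h\!\left(\frac{W}{\sigma}\right)-\mathbb{E}h(Z)\right|\le\frac{\|f_h''\|}{\sigma^3}\sum_{i=1}^\infty\left(\frac12\mathbb{E}|X_i|^3+\sigma_i^2\,\mathbb{E}|X_i|\right)P(N\ge i)^2+2\|f_h'\|\,P(N<I),$$ where $Z\sim\mathcal{N}(0,1)$.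
   Context: Stein's equation for $h$ is $f'(w)-wf(w)=h(w)-\mathbb{E}h(Z)$, $w\in\mathbb{R}$, with $Z\sim\mathcal N(0,1)$; $f_h$ denotes its (unique) bounded solution. $\|\cdot\|$ is the supremum norm on $\mathbb{R}$ (essential supremum for $f_h''$, which exists almost everywhere). The definition of $I$ presupposes $0<\sigma^2<\infty$. *)

theory Defs
  imports "HOL-Probability.Probability"
begin

(* Independence of two random variables. The library's indep_var forces both variables to have
   the same range type, which is too narrow for N (natural numbers) against the whole
   sequence X_1, X_2, ... (a point of a product space). *)
definition (in prob_space) indep_rv ::
    "'b measure \<Rightarrow> ('a \<Rightarrow> 'b) \<Rightarrow> 'c measure \<Rightarrow> ('a \<Rightarrow> 'c) \<Rightarrow> bool" where
  "indep_rv S Y T Z \<longleftrightarrow>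
     random_variable S Y \<and> random_variable T Z \<and>
     indep_set {Y -` A \<inter> space M | A. A \<in> sets S} {Z -` B \<inter> space M | B. B \<in> sets T}"

definition random_sum :: "(nat \<Rightarrow> 'a \<Rightarrow> real) \<Rightarrow> ('a \<Rightarrow> nat) \<Rightarrow> 'a \<Rightarrow> real" where
  "random_sum X N \<omega> = (\<Sum>i = 1..N \<omega>. X i \<omega>)"

definition normal_mean :: "(real \<Rightarrow> real) \<Rightarrow> real" where
  "normal_mean h = (\<integral>z. h z \<partial>std_normal_distribution)"

definition bounded_stein_solution :: "(real \<Rightarrow> real) \<Rightarrow> (real \<Rightarrow> real) \<Rightarrow> bool" where
  "bounded_stein_solution h f \<longleftrightarrow>
     bounded (range f) \<and>
     (\<forall>w. f field_differentiable at w \<and> deriv f w - w * f w = h w - normal_mean h)"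

(* The norms are ennreal-valued, so that no finiteness has to be presupposed. *)
definition sup_norm :: "(real \<Rightarrow> real) \<Rightarrow> ennreal" where
  "sup_norm g = (SUP w. ennreal \<bar>g w\<bar>)"

(* deriv takes an unspecified value where the derivative does not exist; for a second derivative
   that exists almost everywhere, the essential supremum does not see this null set. Using
   lebesgue rather than lborel makes measurability insensitive to null sets as well. *)
definition ess_sup_norm :: "(real \<Rightarrow> real) \<Rightarrow> ennreal" where
  "ess_sup_norm g = esssup lebesgue (\<lambda>w. ennreal \<bar>g w\<bar>)"

(* Third moments may be infinite, hence absolute moments in ennreal. *)
definition abs_moment :: "'a measure \<Rightarrow> nat \<Rightarrow> ('a \<Rightarrow> real) \<Rightarrow> ennreal" where
  "abs_moment M k Y = (\<integral>\<^sup>+\<omega>. ennreal (\<bar>Y \<omega>\<bar> ^ k) \<partial>M)"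

end

theory Submission
  imports Defs
begin

text \<open>Condition on \<open>N\<close> and write \<open>S\<close> for the sum \<open>X\<^sub>1 + \<dots> + X\<^sub>n\<close>. For \<open>i \<le> n\<close>, expanding \<open>f\<close> around
  \<open>S - X\<^sub>i\<close>, which is independent of \<open>X\<^sub>i\<close>, shows that \<open>E X\<^sub>i f(S)\<close> differs from \<open>\<sigma>\<^sub>i\<^sup>2 E f'(S)\<close> by at
  most \<open>\<parallel>f''\<parallel> (E|X\<^sub>i|\<^sup>3 / 2 + \<sigma>\<^sub>i\<^sup>2 E|X\<^sub>i|)\<close>, and that \<open>|E X\<^sub>i f(S)| \<le> \<sigma>\<^sub>i\<^sup>2 \<parallel>f'\<parallel>\<close>. With
  \<open>p = P(N \<ge> i)\<close>, the \<open>i\<close>-th term \<open>\<sigma>\<^sub>i\<^sup>2 p E f'(W) - E X\<^sub>i 1(N \<ge> i) f(W)\<close> is split as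
  \<open>p E[1(N \<ge> i) (\<sigma>\<^sub>i\<^sup>2 f'(W) - X\<^sub>i f(W))]\<close>, which the first estimate controls by \<open>p\<^sup>2\<close>, plus
  \<open>\<sigma>\<^sub>i\<^sup>2 p E[1(N < i) f'(W)] - (1 - p) E[1(N \<ge> i) X\<^sub>i f(W)]\<close>, which is at most
  \<open>2 \<parallel>f'\<parallel> \<sigma>\<^sub>i\<^sup>2 p (1 - p)\<close>; these last terms sum to \<open>2 \<sigma>\<^sup>2 \<parallel>f'\<parallel> P(N < I)\<close>.

  Since \<open>f'(w) = w f(w) + h(w) - E h(Z)\<close> is locally Lipschitz and, by Vitali's covering theorem,
  Lipschitz functions are differentiable almost everywhere, \<open>f'\<close> is Lipschitz with constant
  \<open>\<parallel>f''\<parallel>\<close>. If \<open>\<parallel>f''\<parallel>\<close> is infinite then so is the right-hand side, as \<open>\<sigma> > 0\<close>.\<close>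

section \<open>Lipschitz functions on the real line\<close>

text \<open>Vitali covering argument. Around each point of \<open>E - Z\<close> there are
  arbitrarily short intervals on which \<open>G\<close> grows with slope at most \<open>p\<close>; a
  countable disjoint selection of them covers \<open>E\<close> up to a null set. Monotonicity keeps
  the image intervals disjoint, so their lengths add up to at most \<open>p\<close> times the
  measure of an open superset of \<open>E\<close>, and the Lipschitz condition makes the image of
  the uncovered part null.\<close>

lemma emeasure_image_le_slope:
  fixes G :: "real \<Rightarrow> real"
  assumes G: "strict_mono G"
    and lip: "\<And>x y. \<bar>G x - G y\<bar> \<le> C * \<bar>x - y\<bar>"
    and E: "E \<in> sets lebesgue" and Z: "negligible Z" and p: "0 \<le> p"
    and slope: "\<And>x d. x \<in> E - Z \<Longrightarrow> 0 < d \<Longrightarrow>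
      \<exists>y. y \<noteq> x \<and> \<bar>y - x\<bar> < d \<and> \<bar>G y - G x\<bar> \<le> p * \<bar>y - x\<bar>"
  shows "emeasure lebesgue (G ` E) \<le> ennreal p * emeasure lebesgue E"
proof (rule ennreal_le_epsilon)
  fix e :: real assume e: "0 < e"
  \<comment> \<open>The excess e / (p + 1), multiplied by \<open>p\<close>, stays below
    \<open>e\<close>; the denominator also admits \<open>p = 0\<close>.\<close>
  obtain U where U: "open U" "E \<subseteq> U" "U - E \<in> lmeasurable"
      "emeasure lebesgue (U - E) < ennreal (e / (p + 1))"
    using sets_lebesgue_outer_open[OF E, of "e / (p + 1)"] e p by (auto simp: field_simps)
  \<comment> \<open>An interval is coded by its pair of endpoints; \<open>a\<close> and
    \<open>r\<close> give its centre and radius, since the covering theorem speaks of balls.\<close>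
  define K where "K = {(u, v). u < v \<and> {u..v} \<subseteq> U \<and> G v - G u \<le> p * (v - u)}"
  define a where "a = (\<lambda>(u, v). (u + v) / 2 :: real)"
  define r where "r = (\<lambda>(u, v). (v - u) / 2 :: real)"
  have cball: "cball (a i) (r i) = {fst i..snd i}" for i
    by (auto simp: a_def r_def cball_eq_atLeastAtMost field_simps split: prod.splits)
  have cover: "\<exists>i. i \<in> K \<and> x \<in> cball (a i) (r i) \<and> r i < d" if x: "x \<in> E - Z" and d: "0 < d" for x d
  proof -
    obtain d' where d': "0 < d'" "cball x d' \<subseteq> U"
      using U x open_contains_cball by blast
    obtain y where y: "y \<noteq> x" "\<bar>y - x\<bar> < min d d'" "\<bar>G y - G x\<bar> \<le> p * \<bar>y - x\<bar>"
      using slope[OF x, of "min d d'"] d d' by auto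
    have sub: "{min x y..max x y} \<subseteq> U"
      using d' y(2) by (force simp: cball_eq_atLeastAtMost)
    have "G (max x y) - G (min x y) = \<bar>G y - G x\<bar>"
      using strict_mono_less_eq[OF G, of x y] strict_mono_less_eq[OF G, of y x]
      by (cases "x \<le> y") (simp_all add: max_def min_def)
    moreover have maxmin: "max x y - min x y = \<bar>y - x\<bar>" "min x y < max x y"
      using y(1) by (simp_all add: max_def min_def)
    ultimately have "(min x y, max x y) \<in> K"
      using y(1,3) sub maxmin unfolding K_def by simp
    moreover have "x \<in> cball (a (min x y, max x y)) (r (min x y, max x y))"
      unfolding cball by auto
    moreover have "r (min x y, max x y) < d"
      using y(2) by (auto simp: r_def)
    ultimately show ?thesis by blast
  qed
  have r_pos: "0 < r i" if "i \<in> K" for i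
    using that by (auto simp: K_def r_def)
  obtain D where D: "countable D" "D \<subseteq> K"
      "pairwise (\<lambda>i j. disjnt (cball (a i) (r i)) (cball (a j) (r j))) D"
      "negligible ((E - Z) - (\<Union>i\<in>D. cball (a i) (r i)))"
    using Vitali_covering_theorem_cballs[of K r "E - Z" a, OF r_pos cover] by blast
  define R where "R = E - (\<Union>i\<in>D. {fst i..snd i})"
  have "negligible R"
    by (rule negligible_subset[OF negligible_Un[OF D(4) Z]]) (auto simp: R_def cball)
  then have GR: "negligible (G ` R)"
    by (rule negligible_locally_Lipschitz_image[rotated])
       (use lip in \<open>auto intro!: exI[of _ UNIV] exI[of _ C]\<close>)
  define V where "V = (\<Union>i\<in>D. {G (fst i)..G (snd i)})"
  have disj1: "disjoint_family_on (\<lambda>i. {fst i..snd i}) D"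
    using D(3) by (auto simp: disjoint_family_on_def pairwise_def cball disjnt_def)
  have disj2: "disjoint_family_on (\<lambda>i. {G (fst i)..G (snd i)}) D"
    unfolding disjoint_family_on_def
  proof (intro ballI impI)
    fix i j assume ij: "i \<in> D" "j \<in> D" "i \<noteq> j"
    then have ne: "fst i < snd i" "fst j < snd j"
      using D(2) by (auto simp: K_def)
    have "{fst i..snd i} \<inter> {fst j..snd j} = {}"
      using disj1 ij by (auto simp: disjoint_family_on_def)
    \<comment> \<open>If the two intervals met, the larger left endpoint would lie in both. Hence
      one of them ends before the other starts, an order that \<open>G\<close> preserves.\<close>
    then have "max (fst i) (fst j) \<notin> {fst i..snd i} \<or> max (fst i) (fst j) \<notin> {fst j..snd j}"
      by blast
    then have "snd i < fst j \<or> snd j < fst i"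
      using ne by (auto simp: max_def split: if_splits)
    then have "G (snd i) < G (fst j) \<or> G (snd j) < G (fst i)"
      by (simp only: strict_mono_less[OF G])
    then show "{G (fst i)..G (snd i)} \<inter> {G (fst j)..G (snd j)} = {}"
      by (simp add: disjoint_iff) linarith
  qed
  have sub: "G ` E \<subseteq> G ` R \<union> V"
  proof
    fix z assume "z \<in> G ` E"
    then obtain x where x: "x \<in> E" "z = G x" by auto
    show "z \<in> G ` R \<union> V"
    proof (cases "x \<in> R")
      case False
      then obtain i where "i \<in> D" "fst i \<le> x" "x \<le> snd i" using x by (auto simp: R_def)
      then show ?thesis using x strict_mono_less_eq[OF G] by (auto simp: V_def)
    qed (use x in auto)
  qed
  have Vm: "V \<in> sets lebesgue"
    unfolding V_def using D(1) by (intro sets.countable_UN') auto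
  have "emeasure lebesgue (G ` E) \<le> emeasure lebesgue (G ` R \<union> V)"
    using GR Vm by (intro emeasure_mono sub) (auto simp: negligible_iff_null_sets)
  also have "\<dots> = emeasure lebesgue V"
    using GR Vm by (simp add: Un_commute emeasure_Un_null_set negligible_iff_null_sets)
  also have "\<dots> = (\<integral>\<^sup>+i. emeasure lebesgue {G (fst i)..G (snd i)} \<partial>count_space D)"
    unfolding V_def using D(1) disj2 by (intro emeasure_UN_countable) auto
  also have "\<dots> \<le> (\<integral>\<^sup>+i. ennreal p * emeasure lebesgue {fst i..snd i} \<partial>count_space D)"
  proof (intro nn_integral_mono)
    fix i assume "i \<in> space (count_space D)"
    then have i: "fst i < snd i" "G (snd i) - G (fst i) \<le> p * (snd i - fst i)"
      using D(2) by (auto simp: K_def)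
    then show "emeasure lebesgue {G (fst i)..G (snd i)} \<le> ennreal p * emeasure lebesgue {fst i..snd i}"
      using strict_mono_less[OF G] p by (simp add: less_imp_le ennreal_mult[symmetric] ennreal_leI)
  qed
  also have "\<dots> = ennreal p * (\<integral>\<^sup>+i. emeasure lebesgue {fst i..snd i} \<partial>count_space D)"
    by (rule nn_integral_cmult) auto
  also have "(\<integral>\<^sup>+i. emeasure lebesgue {fst i..snd i} \<partial>count_space D)
      = emeasure lebesgue (\<Union>i\<in>D. {fst i..snd i})"
    using D(1) disj1 by (intro emeasure_UN_countable[symmetric]) auto
  also have "ennreal p * \<dots> \<le> ennreal p * emeasure lebesgue U"
    using D(2) U(1) by (intro mult_left_mono emeasure_mono) (auto simp: K_def subset_iff split: prod.splits)
  also have "emeasure lebesgue U = emeasure lebesgue (E \<union> (U - E))"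
    using U(2) by (simp add: Un_absorb1)
  also have "\<dots> \<le> emeasure lebesgue E + emeasure lebesgue (U - E)"
    using E U(3) by (intro emeasure_subadditive) auto
  also have "\<dots> \<le> emeasure lebesgue E + ennreal (e / (p + 1))"
    using U(4) by (intro add_left_mono) auto
  also have "ennreal p * \<dots> = ennreal p * emeasure lebesgue E + ennreal (p * (e / (p + 1)))"
    using p e by (simp add: distrib_left ennreal_mult[symmetric])
  also have "\<dots> \<le> ennreal p * emeasure lebesgue E + ennreal e"
    using p e by (intro add_left_mono ennreal_leI) (auto simp: field_simps)
  finally show "emeasure lebesgue (G ` E) \<le> ennreal p * emeasure lebesgue E + ennreal e"
    by (simp add: mult_left_mono)
qed

text \<open>Boundedness makes the lower and upper limits finite, so if they were equal there would
  be a real limit. Two rationals fit strictly between them; rationality keeps the number of pairs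
  (p, q) countable when the exceptional sets are united.\<close>

lemma bounded_no_limit_oscillates:
  fixes f :: "'a \<Rightarrow> real"
  assumes F: "F \<noteq> bot" and bnd: "\<forall>\<^sub>F x in F. \<bar>f x\<bar> \<le> B" and nolim: "\<nexists>l. (f \<longlongrightarrow> l) F"
  obtains p q where "p \<in> \<rat>" "q \<in> \<rat>" "p < q" "\<exists>\<^sub>F x in F. f x < p" "\<exists>\<^sub>F x in F. q < f x"
proof -
  let ?a = "Liminf F (\<lambda>x. ereal (f x))" and ?b = "Limsup F (\<lambda>x. ereal (f x))"
  have "ereal (- B) \<le> ?a"
    by (rule Liminf_bounded) (use bnd in eventually_elim, simp)
  moreover have "?b \<le> ereal B"
    by (rule Limsup_bounded) (use bnd in eventually_elim, simp)
  moreover have ab: "?a \<le> ?b"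
    by (rule Liminf_le_Limsup[OF F])
  moreover have "?a \<noteq> ?b"
  proof
    assume eq: "?a = ?b"
    with calculation have "\<bar>?a\<bar> \<noteq> \<infinity>" by auto
    then obtain l where l: "?a = ereal l" by auto
    have "((\<lambda>x. ereal (f x)) \<longlongrightarrow> ereal l) F"
      by (rule Liminf_eq_Limsup[OF F]) (use eq l in auto)
    then show False using nolim by auto
  qed
  ultimately have "?a < ?b" by simp
  then obtain p' where p': "?a < ereal (real_of_rat p')" "ereal (real_of_rat p') < ?b"
    using ereal_dense3 by blast
  obtain q' where q': "ereal (real_of_rat p') < ereal (real_of_rat q')" "ereal (real_of_rat q') < ?b"
    using ereal_dense3[OF p'(2)] by blast
  show thesis
  proof
    show "real_of_rat p' < real_of_rat q'" using q'(1) by simp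
    show "\<exists>\<^sub>F x in F. f x < real_of_rat p'"
    proof (rule ccontr)
      assume "\<not> ?thesis"
      then have "\<forall>\<^sub>F x in F. ereal (real_of_rat p') \<le> ereal (f x)"
        by (simp add: not_frequently not_less)
      then have "ereal (real_of_rat p') \<le> ?a" by (rule Liminf_bounded)
      with p'(1) show False by simp
    qed
    show "\<exists>\<^sub>F x in F. real_of_rat q' < f x"
    proof (rule ccontr)
      assume "\<not> ?thesis"
      then have "\<forall>\<^sub>F x in F. ereal (f x) \<le> ereal (real_of_rat q')"
        by (simp add: not_frequently not_less)
      then have "?b \<le> ereal (real_of_rat q')" by (rule Limsup_bounded)
      with q'(2) show False by simp
    qed
  qed auto
qed

text \<open>If \<open>h\<close> is not differentiable at the points of \<open>E\<close>, then for suitable \<open>p < q\<close> the difference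
  quotients of \<open>G = h + (C + 1) id\<close> are frequently below \<open>p\<close> and frequently above \<open>q\<close>. Comparing
  measures for \<open>G\<close> and for its inverse gives \<open>|E| \<le> |G E| / q \<le> p |E| / q\<close>.\<close>

lemma lipschitz_imp_AE_differentiable:
  fixes h :: "real \<Rightarrow> real"
  assumes lip: "\<And>x y. \<bar>h x - h y\<bar> \<le> C * \<bar>x - y\<bar>"
  shows "negligible {x. \<not> h field_differentiable at x}"
proof -
  have "0 \<le> \<bar>h 1 - h 0\<bar>" by simp
  also have "\<dots> \<le> C" using lip[of 1 0] by simp
  finally have C: "0 \<le> C" .
  \<comment> \<open>Adding (C + 1) x moves all difference quotients into the interval from 1 to 2 C
    + 1. Then \<open>G\<close> is an increasing bijection with a 1-Lipschitz inverse, and is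
    differentiable exactly where \<open>h\<close> is.\<close>
  define G where "G x = h x + (C + 1) * x" for x
  have G_diff: "x - y \<le> G x - G y \<and> G x - G y \<le> (2 * C + 1) * (x - y)" if "y \<le> x" for x y
  proof -
    have "\<bar>h x - h y\<bar> \<le> C * (x - y)" using lip[of x y] that by simp
    then show ?thesis
      unfolding abs_le_iff by (simp add: G_def algebra_simps)
  qed
  have G_abs: "\<bar>x - y\<bar> \<le> \<bar>G x - G y\<bar> \<and> \<bar>G x - G y\<bar> \<le> (2 * C + 1) * \<bar>x - y\<bar>" for x y
  proof (cases "y \<le> x")
    case True
    with G_diff[OF True] show ?thesis by simp
  next
    case False
    with G_diff[of x y] show ?thesis by simp
  qed
  have mono: "strict_mono G"
  proof (rule strict_monoI)
    fix x y :: real assume "x < y"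
    then show "G x < G y" using G_diff[of x y] by simp
  qed
  have "(2 * C + 1)-lipschitz_on UNIV G"
    using G_abs C by (intro lipschitz_onI) (auto simp: dist_real_def)
  then have cont: "continuous_on UNIV G"
    by (rule lipschitz_on_continuous_on)
  have "\<exists>x. G x = z" for z
  proof -
    \<comment> \<open>Slopes are at least 1, so moving from 0 by |z - G 0| in the right direction
      carries \<open>G\<close> at least as far as \<open>z\<close>.\<close>
    let ?t = "\<bar>z - G 0\<bar>"
    have "G (- ?t) \<le> z" "z \<le> G ?t"
      using G_diff[of "- ?t" 0] G_diff[of 0 ?t] by linarith+
    then show ?thesis
      using IVT'[of G "- ?t" z ?t] continuous_on_subset[OF cont] by auto
  qed
  then have surj: "surj G" by (metis surjI)
  define H where "H = inv G"
  have HG: "H (G x) = x" for x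
    unfolding H_def using mono by (simp add: strict_mono_imp_inj_on)
  have GH: "G (H z) = z" for z
    unfolding H_def using surj by (simp add: surj_f_inv_f)
  have H_lip: "\<bar>H x - H y\<bar> \<le> 1 * \<bar>x - y\<bar>" for x y
    using G_abs[of "H x" "H y"] by (simp add: GH)
  have H_mono: "strict_mono H"
    by (rule strict_monoI) (use strict_mono_less[OF mono] GH in metis)
  have "1-lipschitz_on UNIV H"
    using H_lip by (intro lipschitz_onI) (auto simp: dist_real_def)
  then have "continuous_on UNIV H"
    by (rule lipschitz_on_continuous_on)
  then have H_meas: "H \<in> borel_measurable borel"
    by (rule borel_measurable_continuous_onI)
  \<comment> \<open>Points with arbitrarily short difference quotients below \<open>p\<close>;
    \<open>hi q\<close> has those above \<open>q\<close>. Strict inequalities and the countably many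
    scales 1 / (n + 1) present both sets as countable intersections of open sets, hence as Borel
    sets.\<close>
  define lo where "lo p = {x. \<forall>n::nat. \<exists>y. y \<noteq> x \<and> \<bar>y - x\<bar> < inverse (Suc n) \<and>
      \<bar>G y - G x\<bar> < p * \<bar>y - x\<bar>}" for p
  define hi where "hi q = {x. \<forall>n::nat. \<exists>y. y \<noteq> x \<and> \<bar>y - x\<bar> < inverse (Suc n) \<and>
      q * \<bar>y - x\<bar> < \<bar>G y - G x\<bar>}" for q
  have lo_borel: "lo p \<in> sets borel" for p
  proof -
    have "open (\<Union>y. {x. y \<noteq> x \<and> \<bar>y - x\<bar> < inverse (Suc n) \<and> \<bar>G y - G x\<bar> < p * \<bar>y - x\<bar>})" for n :: nat
      by (intro open_UN ballI open_Collect_conj open_Collect_neq open_Collect_less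
          continuous_intros cont)
    then have "(\<Inter>n::nat. \<Union>y. {x. y \<noteq> x \<and> \<bar>y - x\<bar> < inverse (Suc n) \<and> \<bar>G y - G x\<bar> < p * \<bar>y - x\<bar>}) \<in> sets borel"
      by (intro sets.countable_INT) auto
    also have "(\<Inter>n::nat. \<Union>y. {x. y \<noteq> x \<and> \<bar>y - x\<bar> < inverse (Suc n) \<and> \<bar>G y - G x\<bar> < p * \<bar>y - x\<bar>}) = lo p"
      by (auto simp: lo_def)
    finally show ?thesis .
  qed
  have hi_borel: "hi q \<in> sets borel" for q
  proof -
    have "open (\<Union>y. {x. y \<noteq> x \<and> \<bar>y - x\<bar> < inverse (Suc n) \<and> q * \<bar>y - x\<bar> < \<bar>G y - G x\<bar>})" for n :: nat
      by (intro open_UN ballI open_Collect_conj open_Collect_neq open_Collect_less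
          continuous_intros cont)
    then have "(\<Inter>n::nat. \<Union>y. {x. y \<noteq> x \<and> \<bar>y - x\<bar> < inverse (Suc n) \<and> q * \<bar>y - x\<bar> < \<bar>G y - G x\<bar>}) \<in> sets borel"
      by (intro sets.countable_INT) auto
    also have "(\<Inter>n::nat. \<Union>y. {x. y \<noteq> x \<and> \<bar>y - x\<bar> < inverse (Suc n) \<and> q * \<bar>y - x\<bar> < \<bar>G y - G x\<bar>}) = hi q"
      by (auto simp: hi_def)
    finally show ?thesis .
  qed
  \<comment> \<open>The cut to a bounded interval makes the measure finite; only then does |E| \<le>
    (p / q) |E| with p / q < 1 force |E| = 0.\<close>
  have bounded_null: "negligible (lo p \<inter> hi q \<inter> {- real m..real m})" (is "negligible ?E")
    if pq: "0 < p" "p < q" for p q and m :: nat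
  proof -
    have E: "?E \<in> sets borel"
      using lo_borel hi_borel by auto
    have "G ` ?E = H -` ?E \<inter> space borel"
    proof (intro equalityI subsetI)
      fix z assume "z \<in> H -` ?E \<inter> space borel"
      then show "z \<in> G ` ?E" by (intro image_eqI[of _ _ "H z"]) (simp_all add: GH)
    qed (auto simp: HG)
    then have GE: "G ` ?E \<in> sets borel"
      using measurable_sets[OF H_meas E] by simp
    have 1: "emeasure lebesgue (G ` ?E) \<le> ennreal p * emeasure lebesgue ?E"
    proof (rule emeasure_image_le_slope[OF mono, where Z = "{}" and C = "2 * C + 1"])
      fix x d :: real assume x: "x \<in> ?E - {}" and d: "0 < d"
      obtain n where n: "inverse (real (Suc n)) < d" using reals_Archimedean[OF d] by auto
      obtain y where "y \<noteq> x" "\<bar>y - x\<bar> < inverse (Suc n)" "\<bar>G y - G x\<bar> < p * \<bar>y - x\<bar>"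
        using x by (auto simp: lo_def)
      with n show "\<exists>y. y \<noteq> x \<and> \<bar>y - x\<bar> < d \<and> \<bar>G y - G x\<bar> \<le> p * \<bar>y - x\<bar>"
        by (intro exI[of _ y]) auto
    qed (use G_abs E pq in auto)
    have 2: "emeasure lebesgue (H ` G ` ?E) \<le> ennreal (1 / q) * emeasure lebesgue (G ` ?E)"
    proof (rule emeasure_image_le_slope[OF H_mono, where Z = "{}" and C = 1])
      fix z d :: real assume z: "z \<in> G ` ?E - {}" and d: "0 < d"
      then obtain x where x: "x \<in> ?E" "z = G x" by auto
      \<comment> \<open>\<open>G\<close> stretches distances by at most 2 C + 1, so points this
        close to \<open>x\<close> have images within \<open>d\<close> of \<open>z\<close>. The
        slopes of \<open>H\<close> are the reciprocals of those of \<open>G\<close>: above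
        \<open>q\<close> becomes below 1 / q.\<close>
      have "0 < d / (2 * C + 1)" using d C by simp
      then obtain n where n: "inverse (real (Suc n)) < d / (2 * C + 1)"
        using reals_Archimedean by blast
      obtain y where y: "y \<noteq> x" "\<bar>y - x\<bar> < inverse (Suc n)" "q * \<bar>y - x\<bar> < \<bar>G y - G x\<bar>"
        using x(1) by (auto simp: hi_def)
      have "\<bar>G y - G x\<bar> \<le> (2 * C + 1) * \<bar>y - x\<bar>" using G_abs by blast
      also have "\<dots> < (2 * C + 1) * (d / (2 * C + 1))"
        using y(2) n C by (intro mult_strict_left_mono) linarith+
      also have "\<dots> = d" using C by simp
      finally have "\<bar>G y - z\<bar> < d" using x by simp
      moreover have "\<bar>H (G y) - H z\<bar> \<le> 1 / q * \<bar>G y - z\<bar>"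
        using y(3) pq x by (simp add: HG field_simps)
      moreover have "G y \<noteq> z"
        using y(1) x strict_mono_eq[OF mono] by simp
      ultimately show "\<exists>y. y \<noteq> z \<and> \<bar>y - z\<bar> < d \<and> \<bar>H y - H z\<bar> \<le> 1 / q * \<bar>y - z\<bar>"
        by blast
    qed (use H_lip GE pq in auto)
    have "H ` G ` ?E = ?E" by (simp add: image_image HG)
    with 2 have "emeasure lebesgue ?E \<le> ennreal (1 / q) * emeasure lebesgue (G ` ?E)" by simp
    also have "\<dots> \<le> ennreal (1 / q) * (ennreal p * emeasure lebesgue ?E)"
      by (intro mult_left_mono 1) auto
    also have "\<dots> = ennreal (p / q) * emeasure lebesgue ?E"
      using pq by (simp add: mult.assoc[symmetric] ennreal_mult[symmetric])
    finally have le: "emeasure lebesgue ?E \<le> ennreal (p / q) * emeasure lebesgue ?E" .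
    have fin: "?E \<in> lmeasurable"
    proof (rule fmeasurableI2)
      show "{- real m..real m} \<in> lmeasurable" by simp
      show "?E \<in> sets lebesgue" using E by simp
    qed blast
    then have meas_le: "measure lebesgue ?E \<le> p / q * measure lebesgue ?E"
      using le pq by (simp add: emeasure_eq_measure2 ennreal_mult[symmetric] ennreal_le_iff)
    have "p / q < 1" using pq by simp
    have "measure lebesgue ?E = 0"
    proof (rule ccontr)
      assume "measure lebesgue ?E \<noteq> 0"
      then have "0 < measure lebesgue ?E" by (simp add: zero_less_measure_iff)
      then have "p / q * measure lebesgue ?E < 1 * measure lebesgue ?E"
        by (intro mult_strict_right_mono \<open>p / q < 1\<close>)
      with meas_le show False by simp
    qed
    then show ?thesis
      using fin by (simp add: negligible_iff_measure)
  qed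
  have null: "negligible (lo p \<inter> hi q)" if "0 < p" "p < q" for p q
  proof -
    have "lo p \<inter> hi q = (\<Union>m::nat. lo p \<inter> hi q \<inter> {- real m..real m})"
    proof (intro equalityI subsetI)
      fix x assume x: "x \<in> lo p \<inter> hi q"
      obtain m :: nat where "\<bar>x\<bar> \<le> real m" using real_arch_simple by blast
      then have "x \<in> {- real m..real m}" by auto
      with x show "x \<in> (\<Union>m::nat. lo p \<inter> hi q \<inter> {- real m..real m})" by blast
    qed blast
    also have "negligible \<dots>"
      by (rule negligible_countable_Union) (use bounded_null[OF that] in auto)
    finally show ?thesis .
  qed
  have "x \<in> (\<Union>(p, q)\<in>{(p, q). p \<in> \<rat> \<and> q \<in> \<rat> \<and> 0 < p \<and> p < q}. lo p \<inter> hi q)"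
    if nd: "\<not> h field_differentiable at x" for x
  proof -
    define f where "f y = (G y - G x) / (y - x)" for y
    have f_abs: "\<bar>G y - G x\<bar> = f y * \<bar>y - x\<bar>" if "y \<noteq> x" for y
    proof (cases "x < y")
      case True
      then show ?thesis using G_diff[of x y] by (simp add: f_def)
    next
      case False
      then show ?thesis using G_diff[of y x] that by (simp add: f_def field_simps)
    qed
    have f_bounds: "1 \<le> f y \<and> f y \<le> 2 * C + 1" if "y \<noteq> x" for y
      using G_abs[of y x] that unfolding f_abs[OF that] by simp
    have nolim: "\<nexists>l. (f \<longlongrightarrow> l) (at x)"
    proof
      assume "\<exists>l. (f \<longlongrightarrow> l) (at x)"
      then obtain l where "(G has_field_derivative l) (at x)"
        unfolding has_field_derivative_iff f_def by blast
      then have "((\<lambda>x. G x - (C + 1) * x) has_field_derivative l - (C + 1)) (at x)"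
        by (auto intro!: derivative_eq_intros)
      then show False
        using nd by (auto simp: G_def field_differentiable_def)
    qed
    have bnd: "\<forall>\<^sub>F y in at x. \<bar>f y\<bar> \<le> 2 * C + 1"
      unfolding eventually_at using f_bounds by (intro exI[of _ 1]) (auto simp: abs_le_iff, smt (verit))
    obtain p q where pq: "p \<in> \<rat>" "q \<in> \<rat>" "p < q"
        "\<exists>\<^sub>F y in at x. f y < p" "\<exists>\<^sub>F y in at x. q < f y"
      using bounded_no_limit_oscillates[OF _ bnd nolim] by (metis at_neq_bot)
    have lo: "\<exists>y. y \<noteq> x \<and> \<bar>y - x\<bar> < d \<and> f y < p" if "0 < d" for d
      using pq(4) that unfolding frequently_at by (auto simp: dist_real_def)
    have hi: "\<exists>y. y \<noteq> x \<and> \<bar>y - x\<bar> < d \<and> q < f y" if "0 < d" for d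
      using pq(5) that unfolding frequently_at by (auto simp: dist_real_def)
    \<comment> \<open>Some difference quotient lies below \<open>p\<close>, and all of them are at
      least 1.\<close>
    have "0 < p" using lo[of 1] f_bounds by fastforce
    moreover have "x \<in> lo p"
      unfolding lo_def
    proof (intro CollectI allI)
      fix n :: nat
      obtain y where y: "y \<noteq> x" "\<bar>y - x\<bar> < inverse (Suc n)" "f y < p"
        using lo[of "inverse (Suc n)"] by auto
      then show "\<exists>y. y \<noteq> x \<and> \<bar>y - x\<bar> < inverse (Suc n) \<and> \<bar>G y - G x\<bar> < p * \<bar>y - x\<bar>"
        by (intro exI[of _ y]) (simp add: f_abs)
    qed
    moreover have "x \<in> hi q"
      unfolding hi_def
    proof (intro CollectI allI)
      fix n :: nat
      obtain y where y: "y \<noteq> x" "\<bar>y - x\<bar> < inverse (Suc n)" "q < f y"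
        using hi[of "inverse (Suc n)"] by auto
      then show "\<exists>y. y \<noteq> x \<and> \<bar>y - x\<bar> < inverse (Suc n) \<and> q * \<bar>y - x\<bar> < \<bar>G y - G x\<bar>"
        by (intro exI[of _ y]) (simp add: f_abs)
    qed
    ultimately show ?thesis using pq by auto
  qed
  moreover have "negligible (\<Union>(p, q)\<in>{(p, q). p \<in> \<rat> \<and> q \<in> \<rat> \<and> 0 < p \<and> p < q}. lo p \<inter> hi q)"
  proof (rule negligible_countable_Union)
    have "countable (\<rat> \<times> \<rat> :: (real \<times> real) set)"
      by (intro countable_SIGMA countable_rat)
    then have "countable {(p :: real, q). p \<in> \<rat> \<and> q \<in> \<rat> \<and> 0 < p \<and> p < q}"
      by (rule countable_subset[rotated]) auto
    then show "countable ((\<lambda>(p, q). lo p \<inter> hi q) ` {(p, q). p \<in> \<rat> \<and> q \<in> \<rat> \<and> 0 < p \<and> p < q})"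
      by simp
  qed (use null in auto)
  ultimately show ?thesis
    by (rule_tac negligible_subset) (assumption, blast)
qed

text \<open>A substitute for integrating the derivative: after a linear tilt \<open>g\<close>
  becomes strictly increasing, the image of the interval is again an interval, and the covering
  estimate bounds its length, which is the increment. Adding a linear function shifts slopes and
  increments consistently, so the tilt cancels.\<close>

lemma increment_le_AE_deriv_bound:
  fixes g :: "real \<Rightarrow> real"
  assumes ab: "a < b"
    and lip: "\<And>x y. x \<in> {a..b} \<Longrightarrow> y \<in> {a..b} \<Longrightarrow> \<bar>g x - g y\<bar> \<le> C * \<bar>x - y\<bar>"
    and L: "0 \<le> L" and Z: "negligible Z"
    and deriv: "\<And>x. x \<in> {a<..<b} - Z \<Longrightarrow> \<exists>D. (g has_real_derivative D) (at x) \<and> D \<le> L"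
  shows "g b - g a \<le> L * (b - a)"
proof (rule field_le_epsilon)
  fix e :: real assume e: "0 < e"
  have "0 \<le> \<bar>g b - g a\<bar>" by simp
  also have "\<dots> \<le> C * (b - a)" using lip[of b a] ab by simp
  finally have C: "0 \<le> C" using ab by (simp add: zero_le_mult_iff)
  \<comment> \<open>Clamping to [a, b] makes the tilted function globally Lipschitz and increasing,
    although \<open>g\<close> is controlled on [a, b] only.\<close>
  define c where "c x = max a (min b x)" for x
  have c: "c x \<in> {a..b}" "\<bar>c x - c y\<bar> \<le> \<bar>x - y\<bar>" for x y
    using ab by (auto simp: c_def)
  define G where "G x = g (c x) + (C + 1) * x" for x
  have gc: "\<bar>g (c x) - g (c y)\<bar> \<le> C * \<bar>x - y\<bar>" for x y
    using lip[OF c(1) c(1), of x y] mult_left_mono[OF c(2) C, of x y] by linarith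
  have G_lip: "\<bar>G x - G y\<bar> \<le> (2 * C + 1) * \<bar>x - y\<bar>" for x y
  proof -
    have "\<bar>G x - G y\<bar> = \<bar>(g (c x) - g (c y)) + (C + 1) * (x - y)\<bar>"
      by (simp add: G_def algebra_simps)
    also have "\<dots> \<le> \<bar>g (c x) - g (c y)\<bar> + \<bar>(C + 1) * (x - y)\<bar>"
      by (rule abs_triangle_ineq)
    also have "\<dots> \<le> C * \<bar>x - y\<bar> + (C + 1) * \<bar>x - y\<bar>"
      using gc[of x y] C by (simp add: abs_mult)
    also have "\<dots> = (2 * C + 1) * \<bar>x - y\<bar>" by (simp add: algebra_simps)
    finally show ?thesis .
  qed
  have mono: "strict_mono G"
  proof (rule strict_monoI)
    fix x y :: real assume xy: "x < y"
    then have "\<bar>g (c y) - g (c x)\<bar> \<le> C * (y - x)" using gc[of y x] by simp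
    then show "G x < G y"
      unfolding abs_le_iff using xy by (simp add: G_def algebra_simps)
  qed
  have "(2 * C + 1)-lipschitz_on UNIV G"
    using G_lip C by (intro lipschitz_onI) (auto simp: dist_real_def)
  then have cont: "continuous_on UNIV G"
    by (rule lipschitz_on_continuous_on)
  \<comment> \<open>The slack e / (b - a) lets difference quotients tending to
    \<open>D \<le> L\<close> eventually fall below the bound and costs \<open>e\<close> over the
    whole interval; \<open>C + 1\<close> is the slope of the tilt.\<close>
  define p where "p = L + e / (b - a) + (C + 1)"
  have p: "0 \<le> p" using L e ab C by (simp add: p_def)
  have "emeasure lebesgue (G ` {a<..<b}) \<le> ennreal p * emeasure lebesgue {a<..<b}"
  proof (rule emeasure_image_le_slope[OF mono G_lip _ Z p])
    fix x d :: real assume x: "x \<in> {a<..<b} - Z" and d: "0 < d"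
    obtain D where D: "(g has_real_derivative D) (at x)" "D \<le> L" using deriv[OF x] by blast
    define f where "f y = (g y - g x) / (y - x)" for y
    have "(f \<longlongrightarrow> D) (at x)"
      using D(1) unfolding has_field_derivative_iff f_def .
    then have "\<forall>\<^sub>F y in at x. f y < L + e / (b - a)"
      by (rule order_tendstoD) (use D(2) e ab in \<open>smt (verit) divide_pos_pos\<close>)
    moreover have "\<forall>\<^sub>F y in at x. y \<in> {a<..<b}"
      using x by (intro eventually_at_in_open') auto
    moreover have "\<forall>\<^sub>F y in at x. y \<noteq> x \<and> \<bar>y - x\<bar> < d"
      unfolding eventually_at using d by (auto simp: dist_real_def)
    ultimately have "\<forall>\<^sub>F y in at x. f y < L + e / (b - a) \<and> y \<in> {a<..<b} \<and> y \<noteq> x \<and> \<bar>y - x\<bar> < d"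
      by eventually_elim simp
    then obtain y where y: "f y < L + e / (b - a)" "y \<in> {a<..<b}" "y \<noteq> x" "\<bar>y - x\<bar> < d"
      using eventually_happens'[OF at_neq_bot] by blast
    have "G y - G x = (f y + (C + 1)) * (y - x)"
    proof -
      have "g y - g x = f y * (y - x)" using y(3) by (simp add: f_def)
      moreover have "c x = x" "c y = y" using x y(2) by (auto simp: c_def)
      ultimately show ?thesis by (simp add: G_def algebra_simps)
    qed
    moreover have "0 < (G y - G x) / (y - x)"
      using strict_mono_less[OF mono, of x y] strict_mono_less[OF mono, of y x] y(3)
      unfolding zero_less_divide_iff by linarith
    ultimately have "\<bar>G y - G x\<bar> = (f y + (C + 1)) * \<bar>y - x\<bar>"
      using y(3) by (simp add: abs_mult)
    also have "\<dots> \<le> p * \<bar>y - x\<bar>"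
      using y(1) by (intro mult_right_mono) (auto simp: p_def)
    finally show "\<exists>y. y \<noteq> x \<and> \<bar>y - x\<bar> < d \<and> \<bar>G y - G x\<bar> \<le> p * \<bar>y - x\<bar>"
      using y by blast
  qed auto
  moreover have "G ` {a<..<b} = {G a<..<G b}"
  proof (intro equalityI subsetI)
    fix z assume z: "z \<in> {G a<..<G b}"
    then obtain x where x: "a \<le> x" "x \<le> b" "G x = z"
      using IVT'[of G a z b] ab continuous_on_subset[OF cont] by auto
    moreover have "x \<noteq> a" "x \<noteq> b" using x z by auto
    ultimately show "z \<in> G ` {a<..<b}" by (intro image_eqI[of _ _ x]) auto
  qed (use strict_mono_less[OF mono] in auto)
  moreover have "G a \<le> G b" using strict_mono_less[OF mono] ab by (simp add: less_imp_le)
  ultimately have "G b - G a \<le> p * (b - a)"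
    using ab p by (simp add: ennreal_mult[symmetric] ennreal_le_iff)
  moreover have "p * (b - a) = L * (b - a) + e + (C + 1) * (b - a)"
    using ab by (simp add: p_def distrib_right)
  ultimately show "g b - g a \<le> L * (b - a) + e"
    using ab by (simp add: G_def c_def algebra_simps)
qed


section \<open>Consequences of boundedness of the solution\<close>

lemma bounded_stein_solutionE:
  assumes "bounded_stein_solution h f"
  obtains B where "\<And>w. \<bar>f w\<bar> \<le> B" "\<And>w. (f has_real_derivative deriv f w) (at w)"
    "\<And>w. deriv f w = w * f w + h w - normal_mean h"
proof -
  have "bounded (range f)"
    and f: "\<And>w. f field_differentiable at w" "\<And>w. deriv f w - w * f w = h w - normal_mean h"
    using assms by (auto simp: bounded_stein_solution_def)
  then obtain B where "\<And>w. \<bar>f w\<bar> \<le> B"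
    by (auto simp: bounded_iff)
  moreover have "\<And>w. (f has_real_derivative deriv f w) (at w)"
    using f(1) by (simp add: field_differentiable_derivI)
  moreover have "\<And>w. deriv f w = w * f w + h w - normal_mean h"
    using f(2) by (simp add: algebra_simps eq_diff_eq)
  ultimately show thesis using that by blast
qed

text \<open>By the mean value theorem \<open>f'\<close> equals f (w + 1) - f w, at most 2 B in
  absolute value, at some point within distance 1 of \<open>w\<close>; moving from there to
  \<open>w\<close> costs at most \<open>L\<close>. This makes the supremum norm of the derivative
  finite.\<close>

lemma bounded_lipschitz_deriv_imp_bounded_deriv:
  fixes f :: "real \<Rightarrow> real"
  assumes B: "\<And>w. \<bar>f w\<bar> \<le> B" and f': "\<And>w. (f has_real_derivative f' w) (at w)"
    and L: "\<And>x y. \<bar>f' x - f' y\<bar> \<le> L * \<bar>x - y\<bar>"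
  shows "\<bar>f' w\<bar> \<le> 2 * B + L"
proof -
  obtain z where z: "w < z" "z < w + 1" "f (w + 1) - f w = (w + 1 - w) * f' z"
    using MVT2[of w "w + 1" f f'] f' by auto
  have "0 \<le> \<bar>f' 1 - f' 0\<bar>" by simp
  also have "\<dots> \<le> L" using L[of 1 0] by simp
  finally have "0 \<le> L" .
  have "\<bar>f' w - f' z\<bar> \<le> L * \<bar>w - z\<bar>" by (rule L)
  also have "\<dots> \<le> L * 1" using z \<open>0 \<le> L\<close> by (intro mult_left_mono) auto
  finally have "\<bar>f' w - f' z\<bar> \<le> L" by simp
  moreover have "f' z = f (w + 1) - f w" using z(3) by simp
  ultimately show ?thesis
    using B[of w] B[of "w + 1"] unfolding abs_le_iff by linarith
qed

section \<open>The solution of Stein's equation\<close>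

text \<open>The bound on the essential supremum says nothing about the points where \<open>deriv f\<close> is not
  differentiable, since \<open>deriv\<close> has an arbitrary value there; hence almost everywhere
  differentiability of \<open>h\<close> is needed.\<close>

lemma stein_solution_deriv_lipschitz:
  assumes h: "\<And>x y. \<bar>h y - h x\<bar> \<le> \<bar>y - x\<bar>"
    and f: "bounded_stein_solution h f"
    and L: "0 \<le> L" "ess_sup_norm (deriv (deriv f)) = ennreal L"
  shows "\<bar>deriv f x - deriv f y\<bar> \<le> L * \<bar>x - y\<bar>"
proof -
  obtain B where f_diff: "\<And>w. (f has_real_derivative deriv f w) (at w)"
    and f': "\<And>w. deriv f w = w * f w + h w - normal_mean h"
    using bounded_stein_solutionE[OF f] by metis
  define g where "g = deriv f"
  have f'g: "(f has_real_derivative g w) (at w)" for w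
    using f_diff by (simp add: g_def)
  have g: "g w = w * f w + h w - normal_mean h" for w
    using f' by (simp add: g_def)
  have cont_f: "continuous_on S f" for S
    using f'g DERIV_isCont by (blast intro: continuous_at_imp_continuous_on)
  have "1-lipschitz_on UNIV h"
    using h by (intro lipschitz_onI) (auto simp: dist_real_def)
  then have cont_h: "continuous_on S h" for S
    using lipschitz_on_continuous_on continuous_on_subset by blast
  have cont_g: "continuous_on S g" for S
    unfolding g by (intro continuous_intros cont_f cont_h)
  define Z1 where "Z1 = {w. \<not> h field_differentiable at w}"
  define Z2 where "Z2 = {w. \<not> \<bar>deriv g w\<bar> \<le> L}"
  have Z1: "negligible Z1"
    unfolding Z1_def by (rule lipschitz_imp_AE_differentiable[of _ 1]) (use h in auto)
  have "AE w in lebesgue. ennreal \<bar>deriv g w\<bar> \<le> ennreal L"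
    using esssup_AE[of "\<lambda>w. ennreal \<bar>deriv g w\<bar>" lebesgue] L(2)
    unfolding ess_sup_norm_def g_def by simp
  then have "AE w in lebesgue. \<bar>deriv g w\<bar> \<le> L"
    by eventually_elim (use L(1) in \<open>simp add: ennreal_le_iff\<close>)
  then obtain Z where Z: "Z \<in> null_sets lebesgue" "{w \<in> space lebesgue. \<not> \<bar>deriv g w\<bar> \<le> L} \<subseteq> Z"
    by (auto simp only: eventually_ae_filter)
  have Z2: "negligible Z2"
  proof (rule negligible_subset)
    show "negligible Z" using Z(1) by (simp add: negligible_iff_null_sets)
    show "Z2 \<subseteq> Z" using Z(2) by (simp add: Z2_def)
  qed
  \<comment> \<open>Stein's equation expresses \<open>g\<close> through \<open>f\<close> and
    \<open>h\<close>, so \<open>g\<close> is differentiable wherever \<open>h\<close> is. There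
    \<open>deriv g\<close> is a genuine derivative, to which the almost everywhere bound
    applies.\<close>
  have deriv_g: "(g has_real_derivative deriv g w) (at w) \<and> \<bar>deriv g w\<bar> \<le> L"
    if "w \<notin> Z1 \<union> Z2" for w
  proof -
    have "h field_differentiable at w" using that by (simp add: Z1_def)
    then obtain D where "(h has_real_derivative D) (at w)" by (auto simp: field_differentiable_def)
    then have "((\<lambda>w. w * f w + h w - normal_mean h) has_real_derivative (f w + g w * w + D)) (at w)"
      by (auto intro!: derivative_eq_intros f'g)
    then have "g field_differentiable at w"
      unfolding g[abs_def] field_differentiable_def by blast
    then show ?thesis using that by (simp add: Z2_def field_differentiable_derivI)
  qed
  have main: "\<bar>g b - g a\<bar> \<le> L * (b - a)" if ab: "a < b" for a b
  proof -
    \<comment> \<open>On the compact interval the derivative f w + w g w of w f w is bounded by some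
      \<open>K\<close>, and \<open>h\<close> adds 1 to the Lipschitz constant. This local constant
      depends on the interval, whereas the bound to be reached is \<open>L\<close>.\<close>
    have "bounded ((\<lambda>w. f w + w * g w) ` {a..b})"
      by (intro compact_imp_bounded compact_continuous_image continuous_intros cont_f cont_g compact_Icc)
    then obtain K where K: "\<And>w. w \<in> {a..b} \<Longrightarrow> \<bar>f w + w * g w\<bar> \<le> K"
      unfolding bounded_iff by (metis image_eqI real_norm_def)
    have lip: "\<bar>g x - g y\<bar> \<le> (K + 1) * \<bar>x - y\<bar>" if "x \<in> {a..b}" "y \<in> {a..b}" for x y
    proof -
      have "\<bar>x * f x - y * f y\<bar> \<le> K * \<bar>x - y\<bar>"
      proof -
        have "norm (x * f x - y * f y) \<le> K * norm (x - y)"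
        proof (rule field_differentiable_bound[of "{a..b}" "\<lambda>w. w * f w" "\<lambda>w. f w + w * g w"])
          fix z assume "z \<in> {a..b}"
          show "((\<lambda>w. w * f w) has_field_derivative f z + z * g z) (at z within {a..b})"
            by (rule has_field_derivative_at_within)
               (auto intro!: derivative_eq_intros f'g)
        qed (use K that in auto)
        then show ?thesis by simp
      qed
      then show ?thesis
        using h[of x y] unfolding g by (simp add: distrib_right)
    qed
    have "g b - g a \<le> L * (b - a)"
      by (rule increment_le_AE_deriv_bound[OF ab lip L(1) negligible_Un[OF Z1 Z2]])
         (use deriv_g in \<open>force simp: abs_le_iff\<close>)+
    \<comment> \<open>The increment lemma is one-sided; applied to \<open>- g\<close> it gives the
      lower estimate.\<close>
    moreover have "(- g b) - (- g a) \<le> L * (b - a)"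
    proof (rule increment_le_AE_deriv_bound[OF ab _ L(1) negligible_Un[OF Z1 Z2]])
      show "\<bar>- g x - - g y\<bar> \<le> (K + 1) * \<bar>x - y\<bar>" if "x \<in> {a..b}" "y \<in> {a..b}" for x y
        using lip[OF that] by (simp add: abs_minus_commute)
      fix x assume "x \<in> {a<..<b} - (Z1 \<union> Z2)"
      then have "((\<lambda>x. - g x) has_real_derivative - deriv g x) (at x)" "- deriv g x \<le> L"
        using deriv_g[of x] by (auto intro!: derivative_eq_intros)
      then show "\<exists>D. ((\<lambda>x. - g x) has_real_derivative D) (at x) \<and> D \<le> L" by blast
    qed
    ultimately show ?thesis by (simp add: abs_le_iff)
  qed
  show ?thesis
    using main[of x y] main[of y x] unfolding g_def[symmetric]
    by (cases x y rule: linorder_cases) (simp_all add: abs_minus_commute)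
qed

section \<open>Independence and the contribution of one summand\<close>

lemma taylor_lipschitz_deriv_nonneg:
  fixes f :: "real \<Rightarrow> real"
  assumes f': "\<And>w. (f has_real_derivative f' w) (at w)"
    and L: "\<And>x y. \<bar>f' x - f' y\<bar> \<le> L * \<bar>x - y\<bar>" and y: "0 \<le> y"
  shows "f (r + y) - f r - y * f' r \<le> L * y\<^sup>2 / 2"
proof -
  define u where "u t = f (r + t) - f r - t * f' r - L * t\<^sup>2 / 2" for t
  have "u y \<le> u 0"
  proof (rule DERIV_nonpos_imp_nonincreasing[OF y])
    fix t :: real assume t: "0 \<le> t" "t \<le> y"
    have "((\<lambda>t. f (r + t)) has_real_derivative f' (r + t)) (at t)"
      using DERIV_shift[of f "f' (r + t)" t r] f' by (simp add: add.commute)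
    then have "(u has_real_derivative f' (r + t) - f' r - L * t) (at t)"
      unfolding u_def by (auto intro!: derivative_eq_intros)
    moreover have "f' (r + t) - f' r - L * t \<le> 0"
      using L[of "r + t" r] t by simp
    ultimately show "\<exists>D. (u has_real_derivative D) (at t) \<and> D \<le> 0" by blast
  qed
  then show ?thesis by (simp add: u_def)
qed

text \<open>Both signs of the remainder come from the one-sided bound for \<open>f\<close> and for
  its negative; negative increments reduce to positive ones by the reflection w to f (- w).\<close>

lemma taylor_lipschitz_deriv:
  fixes f :: "real \<Rightarrow> real"
  assumes f': "\<And>w. (f has_real_derivative f' w) (at w)"
    and L: "\<And>x y. \<bar>f' x - f' y\<bar> \<le> L * \<bar>x - y\<bar>"
  shows "\<bar>f (r + y) - f r - y * f' r\<bar> \<le> L * y\<^sup>2 / 2"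
proof -
  have nonneg: "\<bar>g (r + y) - g r - y * g' r\<bar> \<le> L * y\<^sup>2 / 2"
    if g': "\<And>w. (g has_real_derivative g' w) (at w)"
      and gL: "\<And>x y. \<bar>g' x - g' y\<bar> \<le> L * \<bar>x - y\<bar>" and y: "0 \<le> y"
    for g g' :: "real \<Rightarrow> real" and r y
  proof -
    have "g (r + y) - g r - y * g' r \<le> L * y\<^sup>2 / 2"
      by (rule taylor_lipschitz_deriv_nonneg[OF g' gL y])
    moreover have "(- g (r + y)) - (- g r) - y * (- g' r) \<le> L * y\<^sup>2 / 2"
    proof (rule taylor_lipschitz_deriv_nonneg[OF _ _ y])
      show "((\<lambda>w. - g w) has_real_derivative - g' w) (at w)" for w
        by (rule DERIV_minus[OF g'])
      show "\<bar>- g' x - - g' y\<bar> \<le> L * \<bar>x - y\<bar>" for x y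
        using gL[of y x] by (simp add: abs_minus_commute)
    qed
    ultimately show ?thesis unfolding abs_le_iff by linarith
  qed
  show ?thesis
  proof (cases "0 \<le> y")
    case True
    then show ?thesis by (rule nonneg[OF f' L])
  next
    case False
    have "((\<lambda>w. f (- w)) has_real_derivative - f' (- w)) (at w)" for w
      using DERIV_chain'[OF DERIV_minus[OF DERIV_ident] f', of w] by simp
    moreover have "\<bar>- f' (- x) - - f' (- y)\<bar> \<le> L * \<bar>x - y\<bar>" for x y
      using L[of "- y" "- x"] by (simp add: abs_minus_commute)
    ultimately have "\<bar>f (- (- r + - y)) - f (- (- r)) - (- y) * - f' (- (- r))\<bar> \<le> L * (- y)\<^sup>2 / 2"
      by (rule nonneg) (use False in auto)
    then show ?thesis by (simp add: add.commute)
  qed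
qed

context prob_space
begin

section \<open>Independence of two random variables and of reindexed families\<close>

lemma indep_rv_measurable:
  assumes "indep_rv S Y T Z"
  shows "random_variable S Y" "random_variable T Z"
  using assms by (auto simp: indep_rv_def)

lemma indep_rv_compose:
  assumes ind: "indep_rv S Y T Z" and g: "g \<in> S \<rightarrow>\<^sub>M S'" and k: "k \<in> T \<rightarrow>\<^sub>M T'"
  shows "indep_rv S' (\<lambda>\<omega>. g (Y \<omega>)) T' (\<lambda>\<omega>. k (Z \<omega>))"
proof -
  note [measurable] = indep_rv_measurable[OF ind] g k
  have Y: "Y \<in> space M \<rightarrow> space S" and Z: "Z \<in> space M \<rightarrow> space T"
    using measurable_space[OF indep_rv_measurable(1)[OF ind]]
      measurable_space[OF indep_rv_measurable(2)[OF ind]] by auto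
  have "indep_set {Y -` A \<inter> space M | A. A \<in> sets S} {Z -` B \<inter> space M | B. B \<in> sets T}"
    using ind by (simp add: indep_rv_def)
  moreover have "{(\<lambda>\<omega>. g (Y \<omega>)) -` A \<inter> space M | A. A \<in> sets S'}
      \<subseteq> {Y -` A \<inter> space M | A. A \<in> sets S}"
  proof clarify
    fix A assume "A \<in> sets S'"
    then have "g -` A \<inter> space S \<in> sets S" by (rule measurable_sets[OF g])
    moreover have "(\<lambda>\<omega>. g (Y \<omega>)) -` A \<inter> space M = Y -` (g -` A \<inter> space S) \<inter> space M"
      using Y by (auto simp only: vimage_eq Int_iff dest: funcset_mem)
    ultimately show "\<exists>A'. (\<lambda>\<omega>. g (Y \<omega>)) -` A \<inter> space M = Y -` A' \<inter> space M \<and> A' \<in> sets S"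
      by blast
  qed
  moreover have "{(\<lambda>\<omega>. k (Z \<omega>)) -` A \<inter> space M | A. A \<in> sets T'}
      \<subseteq> {Z -` A \<inter> space M | A. A \<in> sets T}"
  proof clarify
    fix A assume "A \<in> sets T'"
    then have "k -` A \<inter> space T \<in> sets T" by (rule measurable_sets[OF k])
    moreover have "(\<lambda>\<omega>. k (Z \<omega>)) -` A \<inter> space M = Z -` (k -` A \<inter> space T) \<inter> space M"
      using Z by (auto simp only: vimage_eq Int_iff dest: funcset_mem)
    ultimately show "\<exists>A'. (\<lambda>\<omega>. k (Z \<omega>)) -` A \<inter> space M = Z -` A' \<inter> space M \<and> A' \<in> sets T"
      by blast
  qed
  ultimately have "indep_set {(\<lambda>\<omega>. g (Y \<omega>)) -` A \<inter> space M | A. A \<in> sets S'}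
      {(\<lambda>\<omega>. k (Z \<omega>)) -` A \<inter> space M | A. A \<in> sets T'}"
    unfolding indep_sets2_eq by (meson subset_iff)
  then show ?thesis
    unfolding indep_rv_def by simp
qed

text \<open>\<open>indep_var\<close> asks for independence of the generated \<sigma>-algebras, and
  the preimages of a \<sigma>-algebra already form one. This gives access to the product rule for
  expectations once both ranges have the same type.\<close>

lemma indep_rv_imp_indep_var:
  assumes "indep_rv S Y T Z"
  shows "indep_var S Y T Z"
proof -
  have "Y \<in> space M \<rightarrow> space S" "Z \<in> space M \<rightarrow> space T"
    using measurable_space[OF indep_rv_measurable(1)[OF assms]]
      measurable_space[OF indep_rv_measurable(2)[OF assms]] by auto
  then have "sigma_sets (space M) {Y -` A \<inter> space M | A. A \<in> sets S} = {Y -` A \<inter> space M | A. A \<in> sets S}"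
    "sigma_sets (space M) {Z -` A \<inter> space M | A. A \<in> sets T} = {Z -` A \<inter> space M | A. A \<in> sets T}"
    by (simp_all only: sets_vimage_algebra[symmetric] sets_vimage_algebra2)
  then show ?thesis
    using assms by (simp add: indep_var_eq indep_rv_def)
qed

lemma indep_rv_prob:
  assumes "indep_rv S Y T Z" "A \<in> sets S" "B \<in> sets T"
  shows "\<P>(\<omega> in M. Y \<omega> \<in> A \<and> Z \<omega> \<in> B) = \<P>(\<omega> in M. Y \<omega> \<in> A) * \<P>(\<omega> in M. Z \<omega> \<in> B)"
proof -
  have "prob ((Y -` A \<inter> space M) \<inter> (Z -` B \<inter> space M)) = prob (Y -` A \<inter> space M) * prob (Z -` B \<inter> space M)"
    by (rule indep_setD) (use assms in \<open>auto simp: indep_rv_def\<close>)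
  moreover have "(Y -` A \<inter> space M) \<inter> (Z -` B \<inter> space M) = {\<omega> \<in> space M. Y \<omega> \<in> A \<and> Z \<omega> \<in> B}"
    "Y -` A \<inter> space M = {\<omega> \<in> space M. Y \<omega> \<in> A}" "Z -` B \<inter> space M = {\<omega> \<in> space M. Z \<omega> \<in> B}"
    by auto
  ultimately show ?thesis by simp
qed

text \<open>A finite subfamily is transported along \<open>f\<close> by its inverse on that
  subfamily. The purpose is to renumber the summands 1, 2, ... as 0, 1, ...\<close>

lemma indep_sets_reindex:
  assumes f: "inj_on f I" and F: "indep_sets F (f ` I)"
  shows "indep_sets (\<lambda>i. F (f i)) I"
proof (rule indep_setsI)
  show "F (f i) \<subseteq> events" if "i \<in> I" for i
    using F that by (auto simp: indep_sets_def)
  fix A J assume J: "J \<noteq> {}" "J \<subseteq> I" "finite J" and A: "\<forall>j\<in>J. A j \<in> F (f j)"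
  have inj: "inj_on f J" using f J(2) by (rule inj_on_subset)
  let ?A = "\<lambda>k. A (inv_into J f k)"
  have "prob (\<Inter>k\<in>f ` J. ?A k) = (\<Prod>k\<in>f ` J. prob (?A k))"
    by (rule indep_setsD[OF F]) (use J A inj in auto)
  also have "(\<Prod>k\<in>f ` J. prob (?A k)) = (\<Prod>j\<in>J. prob (A j))"
    by (subst prod.reindex[OF inj]) (simp add: inj)
  finally show "prob (\<Inter>j\<in>J. A j) = (\<Prod>j\<in>J. prob (A j))"
    using inj by simp
qed

lemma indep_vars_reindex:
  assumes "inj_on f I" "indep_vars M' X (f ` I)"
  shows "indep_vars (\<lambda>i. M' (f i)) (\<lambda>i. X (f i)) I"
  using assms indep_sets_reindex[of f I "\<lambda>i. {X i -` A \<inter> space M | A. A \<in> sets (M' i)}"]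
  by (auto simp: indep_vars_def2)

text \<open>The zero-bias coupling is replaced by a second-order expansion of \<open>f\<close> around \<open>R\<close>, which
  yields the same constants.\<close>

lemma stein_summand_bounds:
  fixes Y R :: "'a \<Rightarrow> real" and f f' :: "real \<Rightarrow> real"
  assumes ind: "indep_var borel Y borel R"
    and sq: "integrable M (\<lambda>\<omega>. (Y \<omega>)\<^sup>2)" and mean: "expectation Y = 0"
    and v: "v = expectation (\<lambda>\<omega>. (Y \<omega>)\<^sup>2)"
    and F: "\<And>w. \<bar>f w\<bar> \<le> F" and f': "\<And>w. (f has_real_derivative f' w) (at w)"
    and L: "0 \<le> L" "\<And>x y. \<bar>f' x - f' y\<bar> \<le> L * \<bar>x - y\<bar>" and B: "\<And>w. \<bar>f' w\<bar> \<le> B"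
  shows "\<bar>expectation (\<lambda>\<omega>. Y \<omega> * f (R \<omega> + Y \<omega>))\<bar> \<le> B * v"
    and "ennreal \<bar>v * expectation (\<lambda>\<omega>. f' (R \<omega> + Y \<omega>)) - expectation (\<lambda>\<omega>. Y \<omega> * f (R \<omega> + Y \<omega>))\<bar>
      \<le> ennreal L * (ennreal (1 / 2) * abs_moment M 3 Y + ennreal v * abs_moment M 1 Y)"
proof -
  have Y[measurable]: "Y \<in> borel_measurable M" and R[measurable]: "R \<in> borel_measurable M"
    using ind by (auto dest: indep_var_rv1 indep_var_rv2)
  have "continuous_on UNIV f"
    using f' DERIV_isCont by (blast intro: continuous_at_imp_continuous_on)
  then have f[measurable]: "f \<in> borel_measurable borel"
    by (rule borel_measurable_continuous_onI)
  have "L-lipschitz_on UNIV f'"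
    using L by (intro lipschitz_onI) (auto simp: dist_real_def)
  then have f'm[measurable]: "f' \<in> borel_measurable borel"
    by (intro borel_measurable_continuous_onI lipschitz_on_continuous_on)
  have intY: "integrable M Y"
    by (rule square_integrable_imp_integrable[OF Y sq])
  have v0: "0 \<le> v" unfolding v by simp
  have int_f: "integrable M (\<lambda>\<omega>. f (U \<omega>))" and int_f': "integrable M (\<lambda>\<omega>. f' (U \<omega>))"
    and int_Yf: "integrable M (\<lambda>\<omega>. Y \<omega> * f (U \<omega>))" and int_YYf': "integrable M (\<lambda>\<omega>. (Y \<omega>)\<^sup>2 * f' (U \<omega>))"
    if [measurable]: "U \<in> borel_measurable M" for U
  proof -
    show "integrable M (\<lambda>\<omega>. f (U \<omega>))"
      by (rule integrable_const_bound[where B = F]) (use F in auto)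
    show "integrable M (\<lambda>\<omega>. f' (U \<omega>))"
      by (rule integrable_const_bound[where B = B]) (use B in auto)
    show "integrable M (\<lambda>\<omega>. Y \<omega> * f (U \<omega>))"
    proof (rule Bochner_Integration.integrable_bound)
      show "integrable M (\<lambda>\<omega>. F * Y \<omega>)" using intY by simp
      have "\<bar>Y \<omega> * f (U \<omega>)\<bar> \<le> \<bar>F * Y \<omega>\<bar>" for \<omega>
        using mult_left_mono[OF F, of "\<bar>Y \<omega>\<bar>" "U \<omega>"] F[of 0] by (simp add: abs_mult mult.commute)
      then show "AE \<omega> in M. norm (Y \<omega> * f (U \<omega>)) \<le> norm (F * Y \<omega>)" by simp
    qed measurable
    show "integrable M (\<lambda>\<omega>. (Y \<omega>)\<^sup>2 * f' (U \<omega>))"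
    proof (rule Bochner_Integration.integrable_bound)
      show "integrable M (\<lambda>\<omega>. B * (Y \<omega>)\<^sup>2)" using sq by simp
      have "\<bar>(Y \<omega>)\<^sup>2 * f' (U \<omega>)\<bar> \<le> \<bar>B * (Y \<omega>)\<^sup>2\<bar>" for \<omega>
        using mult_left_mono[OF B, of "(Y \<omega>)\<^sup>2" "U \<omega>"] B[of 0] by (simp add: abs_mult mult.commute)
      then show "AE \<omega> in M. norm ((Y \<omega>)\<^sup>2 * f' (U \<omega>)) \<le> norm (B * (Y \<omega>)\<^sup>2)" by simp
    qed measurable
  qed
  \<comment> \<open>Independence of \<open>Y\<close> and \<open>R\<close> evaluates the first two
    terms of the expansion around \<open>R\<close>: the one with f (R) vanishes because
    \<open>Y\<close> is centred, and the one with f' (R) gets the factor \<open>v\<close>.\<close>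
  have "indep_var borel ((\<lambda>y. y) \<circ> Y) borel (f \<circ> R)"
    by (rule indep_var_compose[OF ind]) auto
  then have YfR: "expectation (\<lambda>\<omega>. Y \<omega> * f (R \<omega>)) = 0"
    using indep_var_lebesgue_integral[of Y "\<lambda>\<omega>. f (R \<omega>)"] intY int_f[OF R] mean by (simp add: comp_def)
  have "indep_var borel ((\<lambda>y. y\<^sup>2) \<circ> Y) borel (f' \<circ> R)"
    by (rule indep_var_compose[OF ind]) auto
  then have YYf'R: "expectation (\<lambda>\<omega>. (Y \<omega>)\<^sup>2 * f' (R \<omega>)) = v * expectation (\<lambda>\<omega>. f' (R \<omega>))"
    using indep_var_lebesgue_integral[of "\<lambda>\<omega>. (Y \<omega>)\<^sup>2" "\<lambda>\<omega>. f' (R \<omega>)"] sq int_f'[OF R]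
    by (simp add: comp_def v)
  have f_diff: "\<bar>f (r + y) - f r\<bar> \<le> B * \<bar>y\<bar>" for r y
  proof -
    have "norm (f (r + y) - f r) \<le> B * norm (r + y - r)"
      by (rule field_differentiable_bound[of UNIV f f']) (use f' B in auto)
    then show ?thesis by simp
  qed
  have RY[measurable]: "(\<lambda>\<omega>. R \<omega> + Y \<omega>) \<in> borel_measurable M" by measurable
  show "\<bar>expectation (\<lambda>\<omega>. Y \<omega> * f (R \<omega> + Y \<omega>))\<bar> \<le> B * v"
  proof -
    \<comment> \<open>Subtracting the vanishing term Y f (R) turns f (R + Y) into an increment of
      \<open>f\<close>, which is at most B |Y|; this supplies the second factor |Y| needed for the
      variance.\<close>
    have "expectation (\<lambda>\<omega>. Y \<omega> * f (R \<omega> + Y \<omega>))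
        = expectation (\<lambda>\<omega>. Y \<omega> * f (R \<omega> + Y \<omega>) - Y \<omega> * f (R \<omega>))"
      using int_Yf[OF R] int_Yf[OF RY] YfR by simp
    also have "\<bar>\<dots>\<bar> \<le> expectation (\<lambda>\<omega>. B * (Y \<omega>)\<^sup>2)"
    proof (rule integral_abs_bound[THEN order_trans], rule integral_mono)
      show "integrable M (\<lambda>\<omega>. \<bar>Y \<omega> * f (R \<omega> + Y \<omega>) - Y \<omega> * f (R \<omega>)\<bar>)"
        using int_Yf[OF R] int_Yf[OF RY] by simp
      show "integrable M (\<lambda>\<omega>. B * (Y \<omega>)\<^sup>2)" using sq by simp
      fix \<omega>
      have "\<bar>Y \<omega> * f (R \<omega> + Y \<omega>) - Y \<omega> * f (R \<omega>)\<bar> = \<bar>Y \<omega>\<bar> * \<bar>f (R \<omega> + Y \<omega>) - f (R \<omega>)\<bar>"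
        by (simp add: abs_mult[symmetric] right_diff_distrib)
      also have "\<dots> \<le> \<bar>Y \<omega>\<bar> * (B * \<bar>Y \<omega>\<bar>)"
        by (intro mult_left_mono f_diff) auto
      also have "\<dots> = B * (Y \<omega>)\<^sup>2" by (simp add: power2_eq_square)
      finally show "\<bar>Y \<omega> * f (R \<omega> + Y \<omega>) - Y \<omega> * f (R \<omega>)\<bar> \<le> B * (Y \<omega>)\<^sup>2" .
    qed
    also have "\<dots> = B * v" by (simp add: v)
    finally show ?thesis .
  qed
  \<comment> \<open>\<open>T1\<close> is the remainder of the expansion of Y f (R + Y) around
    \<open>R\<close>, and \<open>T2\<close> the error of replacing f' (R) by f' (R + Y). The
    quantity to be estimated is E T2 - E T1.\<close>
  define T1 where "T1 \<omega> = Y \<omega> * f (R \<omega> + Y \<omega>) - Y \<omega> * f (R \<omega>) - (Y \<omega>)\<^sup>2 * f' (R \<omega>)" for \<omega>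
  define T2 where "T2 \<omega> = v * f' (R \<omega> + Y \<omega>) - v * f' (R \<omega>)" for \<omega>
  have int_T: "integrable M T1" "integrable M T2"
    unfolding T1_def T2_def
    using int_Yf[OF R] int_Yf[OF RY] int_YYf'[OF R] int_f'[OF R] int_f'[OF RY] by auto
  have "expectation T1 = expectation (\<lambda>\<omega>. Y \<omega> * f (R \<omega> + Y \<omega>)) - v * expectation (\<lambda>\<omega>. f' (R \<omega>))"
    unfolding T1_def using int_Yf[OF R] int_Yf[OF RY] int_YYf'[OF R] YfR YYf'R by simp
  moreover have "expectation T2 = v * expectation (\<lambda>\<omega>. f' (R \<omega> + Y \<omega>)) - v * expectation (\<lambda>\<omega>. f' (R \<omega>))"
    unfolding T2_def using int_f'[OF R] int_f'[OF RY] by simp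
  ultimately have "\<bar>v * expectation (\<lambda>\<omega>. f' (R \<omega> + Y \<omega>)) - expectation (\<lambda>\<omega>. Y \<omega> * f (R \<omega> + Y \<omega>))\<bar>
      \<le> \<bar>expectation T1\<bar> + \<bar>expectation T2\<bar>"
    by linarith
  then have "ennreal \<bar>v * expectation (\<lambda>\<omega>. f' (R \<omega> + Y \<omega>)) - expectation (\<lambda>\<omega>. Y \<omega> * f (R \<omega> + Y \<omega>))\<bar>
      \<le> ennreal \<bar>expectation T1\<bar> + ennreal \<bar>expectation T2\<bar>"
    by (simp add: ennreal_leI ennreal_plus[symmetric] del: ennreal_plus)
  \<comment> \<open>The third moment may be infinite, so the expectation is first bounded by a
    nonnegative integral, to which the cubic Taylor estimate applies.\<close>
  moreover have "ennreal \<bar>expectation T1\<bar> \<le> ennreal L * (ennreal (1 / 2) * abs_moment M 3 Y)"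
  proof -
    have "ennreal \<bar>expectation T1\<bar> \<le> (\<integral>\<^sup>+\<omega>. ennreal \<bar>T1 \<omega>\<bar> \<partial>M)"
    using integral_norm_bound_ennreal[OF int_T(1)] by simp
  also have "\<dots> \<le> (\<integral>\<^sup>+\<omega>. ennreal (L / 2) * ennreal (\<bar>Y \<omega>\<bar> ^ 3) \<partial>M)"
  proof (rule nn_integral_mono)
    fix \<omega>
    have "\<bar>T1 \<omega>\<bar> = \<bar>Y \<omega>\<bar> * \<bar>f (R \<omega> + Y \<omega>) - f (R \<omega>) - Y \<omega> * f' (R \<omega>)\<bar>"
      by (simp add: T1_def abs_mult[symmetric] right_diff_distrib power2_eq_square mult.assoc)
    also have "\<dots> \<le> \<bar>Y \<omega>\<bar> * (L * (Y \<omega>)\<^sup>2 / 2)"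
      by (intro mult_left_mono taylor_lipschitz_deriv[OF f' L(2)]) auto
    also have "\<dots> = L / 2 * \<bar>Y \<omega>\<bar> ^ 3"
      by (simp add: power3_eq_cube power2_eq_square abs_mult_self_eq mult_ac)
    finally show "ennreal \<bar>T1 \<omega>\<bar> \<le> ennreal (L / 2) * ennreal (\<bar>Y \<omega>\<bar> ^ 3)"
      using L(1) by (simp add: ennreal_mult[symmetric] ennreal_leI)
  qed
  also have "\<dots> = ennreal (L / 2) * abs_moment M 3 Y"
    unfolding abs_moment_def by (rule nn_integral_cmult) measurable
  also have "ennreal (L / 2) = ennreal L * ennreal (1 / 2)"
    by (subst ennreal_mult[symmetric]) (use L(1) in auto)
    finally show ?thesis by (simp only: mult.assoc)
  qed
  moreover have "ennreal \<bar>expectation T2\<bar> \<le> ennreal L * (ennreal v * abs_moment M 1 Y)"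
  proof -
    have "ennreal \<bar>expectation T2\<bar> \<le> (\<integral>\<^sup>+\<omega>. ennreal \<bar>T2 \<omega>\<bar> \<partial>M)"
    using integral_norm_bound_ennreal[OF int_T(2)] by simp
  also have "\<dots> \<le> (\<integral>\<^sup>+\<omega>. ennreal (L * v) * ennreal (\<bar>Y \<omega>\<bar> ^ 1) \<partial>M)"
  proof (rule nn_integral_mono)
    fix \<omega>
    have "\<bar>T2 \<omega>\<bar> = v * \<bar>f' (R \<omega> + Y \<omega>) - f' (R \<omega>)\<bar>"
      using v0 by (simp add: T2_def right_diff_distrib[symmetric] abs_mult)
    also have "\<dots> \<le> v * (L * \<bar>Y \<omega>\<bar>)"
      using L(2)[of "R \<omega> + Y \<omega>" "R \<omega>"] v0 by (intro mult_left_mono) auto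
    finally show "ennreal \<bar>T2 \<omega>\<bar> \<le> ennreal (L * v) * ennreal (\<bar>Y \<omega>\<bar> ^ 1)"
      using L(1) v0 by (simp add: ennreal_mult[symmetric] ennreal_leI mult_ac)
  qed
  also have "\<dots> = ennreal (L * v) * abs_moment M 1 Y"
    unfolding abs_moment_def by (rule nn_integral_cmult) measurable
  also have "ennreal (L * v) = ennreal L * ennreal v"
    using L(1) v0 by (simp add: ennreal_mult)
    finally show ?thesis by (simp only: mult.assoc)
  qed
  ultimately show "ennreal \<bar>v * expectation (\<lambda>\<omega>. f' (R \<omega> + Y \<omega>)) - expectation (\<lambda>\<omega>. Y \<omega> * f (R \<omega> + Y \<omega>))\<bar>
      \<le> ennreal L * (ennreal (1 / 2) * abs_moment M 3 Y + ennreal v * abs_moment M 1 Y)"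
    unfolding distrib_left by (rule order_trans[OF _ add_mono])
qed

end

section \<open>Random sums\<close>

text \<open>The summands are numbered from 0, so sums run over i < n, and \<open>tail i\<close>, the
  probability of i < N, is P(N \<ge> i + 1): the weight of the summand with number i + 1 in the
  usual counting.\<close>

locale centered_random_sum = prob_space M for M :: "'a measure" +
  fixes X :: "nat \<Rightarrow> 'a \<Rightarrow> real" and N :: "'a \<Rightarrow> nat"
  assumes X_indep: "indep_vars (\<lambda>_. borel) X UNIV"
    and X_sq: "\<And>i. integrable M (\<lambda>\<omega>. (X i \<omega>)\<^sup>2)"
    and X_mean: "\<And>i. expectation (X i) = 0"
    and N_indep: "indep_rv (count_space UNIV) N (\<Pi>\<^sub>M i\<in>UNIV. borel) (\<lambda>\<omega> i. X i \<omega>)"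
    and W_sq: "integrable M (\<lambda>\<omega>. (\<Sum>i<N \<omega>. X i \<omega>)\<^sup>2)"
begin

definition S :: "nat \<Rightarrow> 'a \<Rightarrow> real" where
  "S n \<omega> = (\<Sum>i<n. X i \<omega>)"

definition var :: "nat \<Rightarrow> real" where
  "var i = expectation (\<lambda>\<omega>. (X i \<omega>)\<^sup>2)"

definition tail :: "nat \<Rightarrow> real" where
  "tail i = \<P>(\<omega> in M. i < N \<omega>)"

section \<open>Moments of the partial sums\<close>

lemma var_nonneg: "0 \<le> var i"
  by (simp add: var_def)

lemma tail_bounds: "0 \<le> tail i" "tail i \<le> 1"
  by (simp_all add: tail_def)

lemma X_measurable[measurable]: "X i \<in> borel_measurable M"
  using X_indep by (auto simp: indep_vars_def)

lemma N_measurable[measurable]: "N \<in> M \<rightarrow>\<^sub>M count_space UNIV"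
  by (rule indep_rv_measurable(1)[OF N_indep])

lemma S_measurable[measurable]: "S n \<in> borel_measurable M"
  unfolding S_def by measurable

lemma S_N_measurable[measurable]: "(\<lambda>\<omega>. S (N \<omega>) \<omega>) \<in> borel_measurable M"
  by (rule measurable_compose_countable) measurable

lemma X_integrable: "integrable M (X i)"
  by (rule square_integrable_imp_integrable[OF X_measurable X_sq])

lemma X_S_rest:
  assumes "i \<notin> J" "finite J"
  shows "indep_var borel (X i) borel (\<lambda>\<omega>. \<Sum>j\<in>J. X j \<omega>)"
  by (rule indep_vars_sum) (use assms indep_vars_subset[OF X_indep] in auto)

text \<open>The three claims are proved jointly: in the induction step the cross term
  \<open>X n \<omega> * S n \<omega>\<close> is integrable and has mean zero by independence, which
  uses integrability of \<open>S n\<close>.\<close>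

lemma S_moments:
  shows "integrable M (\<lambda>\<omega>. (S n \<omega>)\<^sup>2)" "expectation (S n) = 0"
    "expectation (\<lambda>\<omega>. (S n \<omega>)\<^sup>2) = (\<Sum>i<n. var i)"
proof (induction n)
  case (Suc n)
  have int_S: "integrable M (S n)"
    by (rule square_integrable_imp_integrable[OF S_measurable Suc(1)])
  have ind: "indep_var borel (X n) borel (S n)"
    using X_S_rest[of n "{..<n}"] by (simp add: S_def[abs_def])
  have XS: "integrable M (\<lambda>\<omega>. X n \<omega> * S n \<omega>)" "expectation (\<lambda>\<omega>. X n \<omega> * S n \<omega>) = 0"
    using indep_var_integrable[OF ind X_integrable int_S]
      indep_var_lebesgue_integral[OF ind X_integrable int_S] X_mean by simp_all
  have eq: "S (Suc n) = (\<lambda>\<omega>. S n \<omega> + X n \<omega>)"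
    by (simp add: S_def fun_eq_iff)
  have eq2: "(\<lambda>\<omega>. (S (Suc n) \<omega>)\<^sup>2) = (\<lambda>\<omega>. (S n \<omega>)\<^sup>2 + 2 * (X n \<omega> * S n \<omega>) + (X n \<omega>)\<^sup>2)"
    by (simp add: eq fun_eq_iff power2_sum)
  show "integrable M (\<lambda>\<omega>. (S (Suc n) \<omega>)\<^sup>2)"
    unfolding eq2 using Suc(1) XS(1) X_sq by auto
  show "expectation (S (Suc n)) = 0"
    unfolding eq using int_S X_integrable Suc(2) X_mean by simp
  show "expectation (\<lambda>\<omega>. (S (Suc n) \<omega>)\<^sup>2) = (\<Sum>i<Suc n. var i)"
    unfolding eq2 using Suc(1,3) XS X_sq by (simp add: var_def)
qed (simp_all add: S_def[abs_def])

lemma S_integrable: "integrable M (S n)"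
  by (rule square_integrable_imp_integrable[OF S_measurable S_moments(1)])

section \<open>Conditioning on the number of summands\<close>

lemma integral_N_levels_sums:
  fixes \<Phi> :: "'a \<Rightarrow> real"
  assumes \<Phi>: "integrable M \<Phi>"
  shows "(\<lambda>n. expectation (\<lambda>\<omega>. if N \<omega> = n then \<Phi> \<omega> else 0)) sums expectation \<Phi>"
proof -
  note [measurable] = borel_measurable_integrable[OF \<Phi>]
  let ?f = "\<lambda>n \<omega>. if N \<omega> = n then \<Phi> \<omega> else 0"
  have single: "(\<lambda>n. ?f n \<omega>) sums \<Phi> \<omega>" for \<omega>
    using sums_single[of "N \<omega>" "\<lambda>_. \<Phi> \<omega>"] by (simp add: eq_commute)
  have int: "integrable M (?f n)" for n
    by (rule Bochner_Integration.integrable_bound[OF \<Phi>]) auto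
  have "(\<lambda>n. expectation (?f n)) sums expectation (\<lambda>\<omega>. \<Sum>n. ?f n \<omega>)"
  proof (rule sums_integral[OF int])
    show "AE \<omega> in M. summable (\<lambda>n. norm (?f n \<omega>))"
    proof (intro always_eventually allI)
      fix \<omega>
      show "summable (\<lambda>n. norm (?f n \<omega>))"
        by (rule summable_finite[of "{N \<omega>}"]) auto
    qed
    \<comment> \<open>The levels of \<open>N\<close> are disjoint, so all partial sums of these
      expectations are at most E |\<Phi>|; the absolute convergence justifies exchanging series and
      expectation.\<close>
    show "summable (\<lambda>n. expectation (\<lambda>\<omega>. norm (?f n \<omega>)))"
    proof (rule summableI_nonneg_bounded)
      fix m
      have "(\<Sum>n<m. expectation (\<lambda>\<omega>. norm (?f n \<omega>))) = expectation (\<lambda>\<omega>. \<Sum>n<m. norm (?f n \<omega>))"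
        using int by (intro Bochner_Integration.integral_sum[symmetric] integrable_norm)
      also have "\<dots> \<le> expectation (\<lambda>\<omega>. \<bar>\<Phi> \<omega>\<bar>)"
      proof (rule integral_mono)
        show "integrable M (\<lambda>\<omega>. \<Sum>n<m. norm (?f n \<omega>))"
          using int by (intro Bochner_Integration.integrable_sum integrable_norm)
        show "integrable M (\<lambda>\<omega>. \<bar>\<Phi> \<omega>\<bar>)" using \<Phi> by simp
        fix \<omega>
        have "(\<Sum>n<m. norm (?f n \<omega>)) = (\<Sum>n<m. if N \<omega> = n then \<bar>\<Phi> \<omega>\<bar> else 0)"
          by (intro sum.cong) auto
        then show "(\<Sum>n<m. norm (?f n \<omega>)) \<le> \<bar>\<Phi> \<omega>\<bar>" by simp
      qed
      finally show "(\<Sum>n<m. expectation (\<lambda>\<omega>. norm (?f n \<omega>))) \<le> expectation (\<lambda>\<omega>. \<bar>\<Phi> \<omega>\<bar>)" .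
    qed simp
  qed
  then show ?thesis using sums_unique[OF single] by simp
qed

text \<open>\<open>N\<close> and the sequence of summands take values in different types. The
  indicator of N = n and \<Phi> of the sequence are both real, so they fall under the product rule
  for independent real variables.\<close>

lemma expectation_on_N_level:
  assumes \<Phi>: "\<Phi> \<in> borel_measurable (\<Pi>\<^sub>M i\<in>UNIV. borel)"
    and int: "integrable M (\<lambda>\<omega>. \<Phi> (\<lambda>i. X i \<omega>))"
  shows "expectation (\<lambda>\<omega>. if N \<omega> = n then \<Phi> (\<lambda>i. X i \<omega>) else 0)
    = \<P>(\<omega> in M. N \<omega> = n) * expectation (\<lambda>\<omega>. \<Phi> (\<lambda>i. X i \<omega>))"
proof -
  have "indep_rv borel (\<lambda>\<omega>. indicator {n} (N \<omega>) :: real) borel (\<lambda>\<omega>. \<Phi> (\<lambda>i. X i \<omega>))"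
    by (rule indep_rv_compose[OF N_indep _ \<Phi>]) simp
  then have "indep_var borel (\<lambda>\<omega>. indicator {n} (N \<omega>) :: real) borel (\<lambda>\<omega>. \<Phi> (\<lambda>i. X i \<omega>))"
    by (rule indep_rv_imp_indep_var)
  moreover have "integrable M (\<lambda>\<omega>. indicator {n} (N \<omega>) :: real)"
  proof (rule integrable_const_bound[where B = 1])
    show "(\<lambda>\<omega>. indicator {n} (N \<omega>) :: real) \<in> borel_measurable M"
      by (rule measurable_compose[OF N_measurable]) simp
  qed auto
  ultimately have "expectation (\<lambda>\<omega>. indicator {n} (N \<omega>) * \<Phi> (\<lambda>i. X i \<omega>))
      = expectation (\<lambda>\<omega>. indicator {n} (N \<omega>)) * expectation (\<lambda>\<omega>. \<Phi> (\<lambda>i. X i \<omega>))"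
    using int by (rule indep_var_lebesgue_integral)
  moreover have "expectation (\<lambda>\<omega>. indicator {n} (N \<omega>)) = \<P>(\<omega> in M. N \<omega> = n)"
  proof -
    have "expectation (\<lambda>\<omega>. indicator {n} (N \<omega>) :: real) = expectation (indicator {\<omega> \<in> space M. N \<omega> = n})"
      by (intro Bochner_Integration.integral_cong) (auto simp: indicator_def)
    then show ?thesis by simp
  qed
  moreover have "(\<lambda>\<omega>. indicator {n} (N \<omega>) * \<Phi> (\<lambda>i. X i \<omega>)) = (\<lambda>\<omega>. if N \<omega> = n then \<Phi> (\<lambda>i. X i \<omega>) else 0)"
    by (auto simp: fun_eq_iff)
  ultimately show ?thesis by simp
qed

lemma expectation_N_sums:
  fixes \<Phi> :: "nat \<Rightarrow> (nat \<Rightarrow> real) \<Rightarrow> real"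
  assumes \<Phi>: "\<And>n. \<Phi> n \<in> borel_measurable (\<Pi>\<^sub>M i\<in>UNIV. borel)"
    and int: "\<And>n. integrable M (\<lambda>\<omega>. \<Phi> n (\<lambda>i. X i \<omega>))"
    and int_N: "integrable M (\<lambda>\<omega>. \<Phi> (N \<omega>) (\<lambda>i. X i \<omega>))"
  shows "(\<lambda>n. \<P>(\<omega> in M. N \<omega> = n) * expectation (\<lambda>\<omega>. \<Phi> n (\<lambda>i. X i \<omega>)))
    sums expectation (\<lambda>\<omega>. \<Phi> (N \<omega>) (\<lambda>i. X i \<omega>))"
proof -
  have "expectation (\<lambda>\<omega>. if N \<omega> = n then \<Phi> (N \<omega>) (\<lambda>i. X i \<omega>) else 0)
      = \<P>(\<omega> in M. N \<omega> = n) * expectation (\<lambda>\<omega>. \<Phi> n (\<lambda>i. X i \<omega>))" for n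
    unfolding expectation_on_N_level[OF \<Phi> int, symmetric]
    by (intro Bochner_Integration.integral_cong) auto
  then show ?thesis
    using integral_N_levels_sums[OF int_N] by simp
qed

text \<open>Here \<open>c n\<close> is the conditional expectation given N = n. By independence both
  sides are the sum of the same series, with weights P(N = n).\<close>

lemma expectation_freeze_N:
  fixes \<Phi> :: "nat \<Rightarrow> (nat \<Rightarrow> real) \<Rightarrow> real"
  assumes \<Phi>: "\<And>n. \<Phi> n \<in> borel_measurable (\<Pi>\<^sub>M i\<in>UNIV. borel)"
    and int: "\<And>n. integrable M (\<lambda>\<omega>. \<Phi> n (\<lambda>i. X i \<omega>))"
    and int_N: "integrable M (\<lambda>\<omega>. \<Phi> (N \<omega>) (\<lambda>i. X i \<omega>))"
    and c: "\<And>n. c n = expectation (\<lambda>\<omega>. \<Phi> n (\<lambda>i. X i \<omega>))"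
    and int_c: "integrable M (\<lambda>\<omega>. c (N \<omega>))"
  shows "expectation (\<lambda>\<omega>. \<Phi> (N \<omega>) (\<lambda>i. X i \<omega>)) = expectation (\<lambda>\<omega>. c (N \<omega>))"
proof -
  have "(\<lambda>n. \<P>(\<omega> in M. N \<omega> = n) * expectation (\<lambda>\<omega>. c n)) sums expectation (\<lambda>\<omega>. c (N \<omega>))"
    by (rule expectation_N_sums[where \<Phi> = "\<lambda>n _. c n"]) (use int_c in auto)
  then have "(\<lambda>n. \<P>(\<omega> in M. N \<omega> = n) * c n) sums expectation (\<lambda>\<omega>. c (N \<omega>))"
    by (simp add: prob_space)
  then show ?thesis
    using expectation_N_sums[OF \<Phi> int int_N] by (simp add: c sums_unique2)
qed

lemma sum_coordinates_measurable:
  "(\<lambda>x. \<Sum>i<n. x i) \<in> borel_measurable (\<Pi>\<^sub>M i\<in>UNIV. borel :: real measure)"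
  by measurable

section \<open>Mean and variance of the random sum\<close>

lemma random_sum_integrable: "integrable M (\<lambda>\<omega>. S (N \<omega>) \<omega>)"
  by (rule square_integrable_imp_integrable[OF S_N_measurable]) (use W_sq in \<open>simp add: S_def\<close>)

lemma random_sum_mean: "expectation (\<lambda>\<omega>. S (N \<omega>) \<omega>) = 0"
  using expectation_freeze_N[of "\<lambda>n x. \<Sum>i<n. x i" "\<lambda>_. 0"] sum_coordinates_measurable
    random_sum_integrable S_integrable S_moments(2) by (simp add: S_def[abs_def])

text \<open>Given N = n the second moment is the sum of the first \<open>n\<close> variances. The
  left side is a nonnegative integral because integrability of the accumulated variance is deduced
  from this identity.\<close>

lemma random_sum_variance_nn:
  "(\<integral>\<^sup>+\<omega>. ennreal (\<Sum>i<N \<omega>. var i) \<partial>M) = ennreal (expectation (\<lambda>\<omega>. (S (N \<omega>) \<omega>)\<^sup>2))"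
proof -
  have sums: "(\<lambda>n. \<P>(\<omega> in M. N \<omega> = n) * (\<Sum>i<n. var i)) sums expectation (\<lambda>\<omega>. (S (N \<omega>) \<omega>)\<^sup>2)"
    using expectation_N_sums[of "\<lambda>n x. (\<Sum>i<n. x i)\<^sup>2"] sum_coordinates_measurable
      W_sq S_moments(1,3) by (simp add: S_def)
  have "(\<integral>\<^sup>+\<omega>. ennreal (\<Sum>i<N \<omega>. var i) \<partial>M)
      = (\<integral>\<^sup>+\<omega>. (\<Sum>n. ennreal (\<Sum>i<n. var i) * indicator {\<omega> \<in> space M. N \<omega> = n} \<omega>) \<partial>M)"
  proof (rule nn_integral_cong)
    fix \<omega> assume "\<omega> \<in> space M"
    then have "(\<Sum>n. ennreal (\<Sum>i<n. var i) * indicator {\<omega> \<in> space M. N \<omega> = n} \<omega>)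
        = (\<Sum>n. if n = N \<omega> then ennreal (\<Sum>i<n. var i) else 0)"
      by (intro suminf_cong) (auto simp: indicator_def)
    also have "\<dots> = ennreal (\<Sum>i<N \<omega>. var i)"
      by (rule sums_unique[OF sums_single, symmetric])
    finally show "ennreal (\<Sum>i<N \<omega>. var i)
      = (\<Sum>n. ennreal (\<Sum>i<n. var i) * indicator {\<omega> \<in> space M. N \<omega> = n} \<omega>)" by simp
  qed
  also have "\<dots> = (\<Sum>n. \<integral>\<^sup>+\<omega>. ennreal (\<Sum>i<n. var i) * indicator {\<omega> \<in> space M. N \<omega> = n} \<omega> \<partial>M)"
    by (intro nn_integral_suminf) measurable
  also have "\<dots> = (\<Sum>n. ennreal (\<P>(\<omega> in M. N \<omega> = n) * (\<Sum>i<n. var i)))"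
    by (intro suminf_cong)
       (simp add: nn_integral_cmult_indicator emeasure_eq_measure ennreal_mult sum_nonneg var_nonneg mult.commute)
  also have "\<dots> = ennreal (expectation (\<lambda>\<omega>. (S (N \<omega>) \<omega>)\<^sup>2))"
    using sums by (intro suminf_ennreal_eq) (simp_all add: sum_nonneg var_nonneg)
  finally show ?thesis .
qed

lemma sum_var_N_integrable: "integrable M (\<lambda>\<omega>. \<Sum>i<N \<omega>. var i)"
  by (rule integrableI_nonneg) (auto simp: random_sum_variance_nn sum_nonneg var_nonneg)

text \<open>The accumulated variance is the series of \<open>var i\<close> times the indicator of i
  < N; its terms are nonnegative, so it may be integrated term by term.\<close>

lemma random_sum_variance_sums: "(\<lambda>i. var i * tail i) sums expectation (\<lambda>\<omega>. (S (N \<omega>) \<omega>)\<^sup>2)"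
proof -
  have "ennreal (expectation (\<lambda>\<omega>. (S (N \<omega>) \<omega>)\<^sup>2))
      = (\<integral>\<^sup>+\<omega>. (\<Sum>i. ennreal (var i) * indicator {\<omega> \<in> space M. i < N \<omega>} \<omega>) \<partial>M)"
    unfolding random_sum_variance_nn[symmetric]
  proof (rule nn_integral_cong)
    fix \<omega> assume \<omega>: "\<omega> \<in> space M"
    have "(\<lambda>i. ennreal (var i) * indicator {\<omega> \<in> space M. i < N \<omega>} \<omega>)
        sums (\<Sum>i<N \<omega>. ennreal (var i) * indicator {\<omega> \<in> space M. i < N \<omega>} \<omega>)"
      by (rule sums_finite) auto
    also have "(\<Sum>i<N \<omega>. ennreal (var i) * indicator {\<omega> \<in> space M. i < N \<omega>} \<omega>) = (\<Sum>i<N \<omega>. ennreal (var i))"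
      using \<omega> by (intro sum.cong) auto
    also have "\<dots> = ennreal (\<Sum>i<N \<omega>. var i)"
      by (simp add: sum_ennreal var_nonneg)
    finally show "ennreal (\<Sum>i<N \<omega>. var i)
      = (\<Sum>i. ennreal (var i) * indicator {\<omega> \<in> space M. i < N \<omega>} \<omega>)"
      by (rule sums_unique)
  qed
  also have "\<dots> = (\<Sum>i. \<integral>\<^sup>+\<omega>. ennreal (var i) * indicator {\<omega> \<in> space M. i < N \<omega>} \<omega> \<partial>M)"
    by (intro nn_integral_suminf) measurable
  also have "\<dots> = (\<Sum>i. ennreal (var i * tail i))"
    by (intro suminf_cong)
       (simp add: nn_integral_cmult_indicator emeasure_eq_measure ennreal_mult var_nonneg tail_def)
  finally have eq: "(\<Sum>i. ennreal (var i * tail i)) = ennreal (expectation (\<lambda>\<omega>. (S (N \<omega>) \<omega>)\<^sup>2))" ..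
  have "(\<lambda>i. ennreal (var i * tail i)) sums ennreal (expectation (\<lambda>\<omega>. (S (N \<omega>) \<omega>)\<^sup>2))"
    using summable_sums[OF summableI, of "\<lambda>i. ennreal (var i * tail i)"] by (simp only: eq)
  then show ?thesis
    by (subst (asm) sums_ennreal) (simp_all add: var_nonneg tail_bounds)
qed


text \<open>Freezing \<open>N\<close> replaces E f' (W) and E W f (W) by expectations of
  \<open>c (N \<omega>)\<close> and of a sum of \<open>b (N \<omega>) i\<close>. Both parts then
  become series over \<open>i\<close>, compared term by term. A general \<open>f\<close> is treated
  so that the rescaled Stein solution can be inserted.\<close>

lemma stein_random_sum_bound:
  fixes f f' :: "real \<Rightarrow> real"
  assumes F: "\<And>w. \<bar>f w\<bar> \<le> F" and f': "\<And>w. (f has_real_derivative f' w) (at w)"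
    and L: "0 \<le> L" "\<And>x y. \<bar>f' x - f' y\<bar> \<le> L * \<bar>x - y\<bar>" and B: "\<And>w. \<bar>f' w\<bar> \<le> B"
  defines "W \<equiv> \<lambda>\<omega>. S (N \<omega>) \<omega>"
  shows "ennreal \<bar>expectation (\<lambda>\<omega>. (W \<omega>)\<^sup>2) * expectation (\<lambda>\<omega>. f' (W \<omega>)) - expectation (\<lambda>\<omega>. W \<omega> * f (W \<omega>))\<bar>
    \<le> ennreal L * (\<Sum>i. (ennreal (1 / 2) * abs_moment M 3 (X i) + ennreal (var i) * abs_moment M 1 (X i))
          * ennreal ((tail i)\<^sup>2))
      + 2 * ennreal B * (\<Sum>i. ennreal (var i * tail i * (1 - tail i)))"
proof -
  have "continuous_on UNIV f"
    using f' DERIV_isCont by (blast intro: continuous_at_imp_continuous_on)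
  then have f[measurable]: "f \<in> borel_measurable borel"
    by (rule borel_measurable_continuous_onI)
  have "L-lipschitz_on UNIV f'"
    using L by (intro lipschitz_onI) (auto simp: dist_real_def)
  then have f'm[measurable]: "f' \<in> borel_measurable borel"
    by (intro borel_measurable_continuous_onI lipschitz_on_continuous_on)
  have B0: "0 \<le> B" using order_trans[OF abs_ge_zero B] .
  have F0: "0 \<le> F" using order_trans[OF abs_ge_zero F] .
  have W[measurable]: "W \<in> borel_measurable M" unfolding W_def by measurable
  have int_f': "integrable M (\<lambda>\<omega>. f' (U \<omega>))" if [measurable]: "U \<in> borel_measurable M" for U
    by (rule integrable_const_bound[where B = B]) (use B in auto)
  have int_f: "integrable M (\<lambda>\<omega>. V \<omega> * f (U \<omega>))"
    if [measurable]: "U \<in> borel_measurable M" and V: "integrable M V" for U V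
  proof (rule Bochner_Integration.integrable_bound)
    note [measurable] = borel_measurable_integrable[OF V]
    show "integrable M (\<lambda>\<omega>. F * V \<omega>)" using V by simp
    have "\<bar>V \<omega> * f (U \<omega>)\<bar> \<le> \<bar>F * V \<omega>\<bar>" for \<omega>
      using mult_left_mono[OF F, of "\<bar>V \<omega>\<bar>" "U \<omega>"] F0 by (simp add: abs_mult mult.commute)
    then show "AE \<omega> in M. norm (V \<omega> * f (U \<omega>)) \<le> norm (F * V \<omega>)" by simp
    show "(\<lambda>\<omega>. V \<omega> * f (U \<omega>)) \<in> borel_measurable M" by measurable
  qed
  define m where "m i = ennreal (1 / 2) * abs_moment M 3 (X i) + ennreal (var i) * abs_moment M 1 (X i)" for i
  define b where "b n i = expectation (\<lambda>\<omega>. X i \<omega> * f (S n \<omega>))" for n i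
  define c where "c n = expectation (\<lambda>\<omega>. f' (S n \<omega>))" for n
  define v2 where "v2 = expectation (\<lambda>\<omega>. (W \<omega>)\<^sup>2)"
  have b_bound: "\<bar>b n i\<bar> \<le> B * var i"
    and b_near: "ennreal \<bar>var i * c n - b n i\<bar> \<le> ennreal L * m i" if "i < n" for n i
  proof -
    \<comment> \<open>Leaving out the summand \<open>X i\<close> gives the variable \<open>R\<close>
      of the one-summand estimates, independent of \<open>X i\<close>.\<close>
    have eq: "S n = (\<lambda>\<omega>. (\<Sum>j\<in>{..<n} - {i}. X j \<omega>) + X i \<omega>)"
      using that by (auto simp: S_def fun_eq_iff sum.remove[of "{..<n}" i] add.commute)
    have ind: "indep_var borel (X i) borel (\<lambda>\<omega>. \<Sum>j\<in>{..<n} - {i}. X j \<omega>)"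
      by (rule X_S_rest) auto
    show "\<bar>b n i\<bar> \<le> B * var i"
      unfolding b_def eq by (rule stein_summand_bounds(1)[OF ind X_sq X_mean var_def F f' L B])
    show "ennreal \<bar>var i * c n - b n i\<bar> \<le> ennreal L * m i"
      unfolding b_def c_def eq m_def
      by (rule stein_summand_bounds(2)[OF ind X_sq X_mean var_def F f' L B])
  qed
  have c_bound: "\<bar>c n\<bar> \<le> B" for n
  proof -
    have "\<bar>c n\<bar> \<le> expectation (\<lambda>\<omega>. \<bar>f' (S n \<omega>)\<bar>)"
      unfolding c_def by (rule integral_abs_bound)
    also have "\<dots> \<le> expectation (\<lambda>\<omega>. B)"
      by (rule integral_mono) (use int_f'[OF S_measurable] B in auto)
    finally show ?thesis by (simp add: prob_space)
  qed
  have int_c: "integrable M (\<lambda>\<omega>. c (N \<omega>))"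
    by (rule integrable_const_bound[where B = B]) (use c_bound in auto)
  have Ec: "expectation (\<lambda>\<omega>. f' (W \<omega>)) = expectation (\<lambda>\<omega>. c (N \<omega>))"
    using expectation_freeze_N[of "\<lambda>n x. f' (\<Sum>i<n. x i)" c] int_f'[OF S_measurable] int_f'[OF W] int_c
    by (simp add: c_def W_def S_def[abs_def])
  have b_sum_bound: "\<bar>\<Sum>i<n. b n i\<bar> \<le> B * (\<Sum>i<n. var i)" for n
    unfolding sum_distrib_left by (rule order_trans[OF sum_abs]) (intro sum_mono b_bound, simp)
  \<comment> \<open>Domination by \<open>B\<close> times the accumulated variance, which is
    integrable since W has a finite second moment.\<close>
  have int_b: "integrable M (\<lambda>\<omega>. \<Sum>i<N \<omega>. b (N \<omega>) i)"
  proof (rule Bochner_Integration.integrable_bound)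
    show "integrable M (\<lambda>\<omega>. B * (\<Sum>i<N \<omega>. var i))" using sum_var_N_integrable by simp
    show "(\<lambda>\<omega>. \<Sum>i<N \<omega>. b (N \<omega>) i) \<in> borel_measurable M"
      by (rule measurable_compose[OF N_measurable]) simp
    show "AE \<omega> in M. norm (\<Sum>i<N \<omega>. b (N \<omega>) i) \<le> norm (B * (\<Sum>i<N \<omega>. var i))"
      by (intro always_eventually allI) (simp only: real_norm_def order_trans[OF b_sum_bound abs_ge_self])
  qed
  have "(\<Sum>i<n. b n i) = expectation (\<lambda>\<omega>. S n \<omega> * f (S n \<omega>))" for n
  proof -
    have "(\<Sum>i<n. b n i) = expectation (\<lambda>\<omega>. \<Sum>i<n. X i \<omega> * f (S n \<omega>))"
      unfolding b_def
      by (intro Bochner_Integration.integral_sum[symmetric] int_f S_measurable X_integrable)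
    then show ?thesis by (simp only: S_def sum_distrib_right)
  qed
  then have Eb: "expectation (\<lambda>\<omega>. W \<omega> * f (W \<omega>)) = expectation (\<lambda>\<omega>. \<Sum>i<N \<omega>. b (N \<omega>) i)"
    using expectation_freeze_N[of "\<lambda>n x. (\<Sum>i<n. x i) * f (\<Sum>i<n. x i)" "\<lambda>n. \<Sum>i<n. b n i"]
      int_f[OF S_measurable S_integrable] int_f[OF S_N_measurable random_sum_integrable] int_b
    by (simp add: W_def S_def[abs_def])
  define bi where "bi i = expectation (\<lambda>\<omega>. if i < N \<omega> then b (N \<omega>) i else 0)" for i
  have expectation_tail: "expectation (\<lambda>\<omega>. if i < N \<omega> then a else 0) = a * tail i" for i and a :: real
  proof -
    have "expectation (\<lambda>\<omega>. if i < N \<omega> then a else 0) = expectation (\<lambda>\<omega>. a * indicator {\<omega> \<in> space M. i < N \<omega>} \<omega>)"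
      by (intro Bochner_Integration.integral_cong) auto
    then show ?thesis by (simp add: tail_def)
  qed
  have int_const: "integrable M (\<lambda>\<omega>. if i < N \<omega> then a else 0)" for i and a :: real
    by (rule integrable_const_bound[where B = "\<bar>a\<bar>"]) auto
  have bi_abs_bound: "integrable M (\<lambda>\<omega>. if i < N \<omega> then b (N \<omega>) i else 0)"
    "expectation (\<lambda>\<omega>. \<bar>if i < N \<omega> then b (N \<omega>) i else 0\<bar>) \<le> B * (var i * tail i)" for i
  proof -
    have *: "\<bar>if i < N \<omega> then b (N \<omega>) i else 0\<bar> \<le> (if i < N \<omega> then B * var i else 0)" for \<omega>
      using b_bound by simp
    show int: "integrable M (\<lambda>\<omega>. if i < N \<omega> then b (N \<omega>) i else 0)"
    proof (rule integrable_const_bound[where B = "B * var i"])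
      show "AE \<omega> in M. norm (if i < N \<omega> then b (N \<omega>) i else 0) \<le> B * var i"
        using b_bound B0 var_nonneg by simp
      show "(\<lambda>\<omega>. if i < N \<omega> then b (N \<omega>) i else 0) \<in> borel_measurable M"
        by (rule measurable_compose[OF N_measurable]) simp
    qed
    have "expectation (\<lambda>\<omega>. \<bar>if i < N \<omega> then b (N \<omega>) i else 0\<bar>)
        \<le> expectation (\<lambda>\<omega>. if i < N \<omega> then B * var i else 0)"
      by (rule integral_mono[OF integrable_abs[OF int] int_const *])
    then show "expectation (\<lambda>\<omega>. \<bar>if i < N \<omega> then b (N \<omega>) i else 0\<bar>) \<le> B * (var i * tail i)"
      by (simp add: expectation_tail mult.assoc)
  qed
  have bi_bound: "\<bar>bi i\<bar> \<le> B * (var i * tail i)" for i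
    unfolding bi_def by (rule order_trans[OF integral_abs_bound bi_abs_bound(2)])
  \<comment> \<open>The exchange of series and expectation is dominated by \<open>B\<close> times
    the convergent variance series.\<close>
  have bi_sums: "bi sums expectation (\<lambda>\<omega>. \<Sum>i<N \<omega>. b (N \<omega>) i)"
  proof -
    have single: "(\<lambda>i. if i < N \<omega> then b (N \<omega>) i else 0) sums (\<Sum>i<N \<omega>. b (N \<omega>) i)" for \<omega>
      using sums_If_finite_set[of "{..<N \<omega>}" "b (N \<omega>)"] by simp
    have "bi sums expectation (\<lambda>\<omega>. \<Sum>i. if i < N \<omega> then b (N \<omega>) i else 0)"
      unfolding bi_def
    proof (rule sums_integral[OF bi_abs_bound(1)])
      show "AE \<omega> in M. summable (\<lambda>i. norm (if i < N \<omega> then b (N \<omega>) i else 0))"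
      proof (intro always_eventually allI)
        fix \<omega>
        show "summable (\<lambda>i. norm (if i < N \<omega> then b (N \<omega>) i else 0))"
          by (rule summable_finite[of "{..<N \<omega>}"]) auto
      qed
      show "summable (\<lambda>i. expectation (\<lambda>\<omega>. norm (if i < N \<omega> then b (N \<omega>) i else 0)))"
      proof (rule summable_comparison_test'[where N = 0])
        show "summable (\<lambda>i. B * (var i * tail i))"
          by (intro summable_mult sums_summable[OF random_sum_variance_sums])
        show "norm (expectation (\<lambda>\<omega>. norm (if i < N \<omega> then b (N \<omega>) i else 0))) \<le> B * (var i * tail i)" for i
          using bi_abs_bound(2)[of i] by simp
      qed
    qed
    then show ?thesis using sums_unique[OF single] by simp
  qed
  define d where "d i = var i * tail i * expectation (\<lambda>\<omega>. c (N \<omega>)) - bi i" for i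
  have d_sums: "d sums (v2 * expectation (\<lambda>\<omega>. c (N \<omega>)) - expectation (\<lambda>\<omega>. \<Sum>i<N \<omega>. b (N \<omega>) i))"
    unfolding d_def v2_def W_def
    by (intro sums_diff sums_mult2 random_sum_variance_sums bi_sums)
  have d_bound: "ennreal \<bar>d i\<bar> \<le> ennreal L * (m i * ennreal ((tail i)\<^sup>2)) + 2 * ennreal B * ennreal (var i * tail i * (1 - tail i))" for i
  proof -
    define g where "g = expectation (\<lambda>\<omega>. if i < N \<omega> then c (N \<omega>) else 0)"
    define e where "e = expectation (\<lambda>\<omega>. if i < N \<omega> then 0 else c (N \<omega>))"
    have int_g: "integrable M (\<lambda>\<omega>. if i < N \<omega> then c (N \<omega>) else 0)"
      by (rule Bochner_Integration.integrable_bound[OF int_c]) auto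
    have int_e: "integrable M (\<lambda>\<omega>. if i < N \<omega> then 0 else c (N \<omega>))"
      by (rule Bochner_Integration.integrable_bound[OF int_c]) auto
    have "expectation (\<lambda>\<omega>. c (N \<omega>))
        = expectation (\<lambda>\<omega>. (if i < N \<omega> then c (N \<omega>) else 0) + (if i < N \<omega> then 0 else c (N \<omega>)))"
      by (intro Bochner_Integration.integral_cong) auto
    then have ge: "expectation (\<lambda>\<omega>. c (N \<omega>)) = g + e"
      using int_g int_e by (simp add: g_def e_def)
    have e_bound: "\<bar>e\<bar> \<le> B * (1 - tail i)"
    proof -
      have "\<bar>e\<bar> \<le> expectation (\<lambda>\<omega>. \<bar>if i < N \<omega> then 0 else c (N \<omega>)\<bar>)"
        unfolding e_def by (rule integral_abs_bound)
      also have "\<dots> \<le> expectation (\<lambda>\<omega>. B - (if i < N \<omega> then B else 0))"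
        using c_bound by (intro integral_mono integrable_abs int_e Bochner_Integration.integrable_diff int_const) auto
      also have "\<dots> = B * (1 - tail i)"
        using int_const[of i B] by (simp add: expectation_tail prob_space algebra_simps)
      finally show ?thesis .
    qed
    \<comment> \<open>The weight \<open>tail i\<close> on the first bracket is one factor of its
      square; the bracket itself supplies the other. Each of the two remaining terms is at most
      \<open>B * (var i * tail i * (1 - tail i))\<close>, whence the constant 2.\<close>
    have "d i = tail i * (var i * g - bi i) + (var i * tail i * e - (1 - tail i) * bi i)"
      by (simp add: d_def ge algebra_simps)
    also have "\<bar>\<dots>\<bar> \<le> tail i * \<bar>var i * g - bi i\<bar> + (var i * tail i * \<bar>e\<bar> + (1 - tail i) * \<bar>bi i\<bar>)"
    proof -
      have "\<bar>tail i * (var i * g - bi i) + (var i * tail i * e - (1 - tail i) * bi i)\<bar>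
          \<le> \<bar>tail i * (var i * g - bi i)\<bar> + (\<bar>var i * tail i * e\<bar> + \<bar>(1 - tail i) * bi i\<bar>)"
        by linarith
      then show ?thesis
        by (simp add: abs_mult tail_bounds var_nonneg)
    qed
    also have "\<dots> \<le> tail i * \<bar>var i * g - bi i\<bar>
        + (var i * tail i * (B * (1 - tail i)) + (1 - tail i) * (B * (var i * tail i)))"
      by (intro add_mono mult_left_mono e_bound bi_bound order_refl)
         (simp_all add: tail_bounds var_nonneg)
    also have "\<dots> = tail i * \<bar>var i * g - bi i\<bar> + 2 * B * (var i * tail i * (1 - tail i))"
      by (simp add: algebra_simps)
    finally have "ennreal \<bar>d i\<bar> \<le> ennreal (tail i * \<bar>var i * g - bi i\<bar> + 2 * B * (var i * tail i * (1 - tail i)))"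
      by (rule ennreal_leI)
    also have "\<dots> = ennreal (tail i) * ennreal \<bar>var i * g - bi i\<bar>
        + ennreal (2 * B * (var i * tail i * (1 - tail i)))"
      using B0 by (simp add: ennreal_plus ennreal_mult tail_bounds var_nonneg)
    also have "ennreal (2 * B * (var i * tail i * (1 - tail i)))
        = 2 * ennreal B * ennreal (var i * tail i * (1 - tail i))"
      using B0 by (simp add: ennreal_mult tail_bounds var_nonneg)
    finally have le: "ennreal \<bar>d i\<bar> \<le> ennreal (tail i) * ennreal \<bar>var i * g - bi i\<bar>
        + 2 * ennreal B * ennreal (var i * tail i * (1 - tail i))" .
    have "ennreal \<bar>var i * g - bi i\<bar> \<le> ennreal L * m i * ennreal (tail i)"
    proof -
      \<comment> \<open>This variable vanishes unless i < N, and there the one-summand estimate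
        holds; integrating it over that event produces the second factor
        \<open>tail i\<close>.\<close>
      let ?u = "\<lambda>\<omega>. var i * (if i < N \<omega> then c (N \<omega>) else 0) - (if i < N \<omega> then b (N \<omega>) i else 0)"
      have int_u: "integrable M ?u"
        using int_g bi_abs_bound(1) by simp
      have "var i * g - bi i = expectation ?u"
        using int_g bi_abs_bound(1) by (simp add: g_def bi_def)
      then have "ennreal \<bar>var i * g - bi i\<bar> \<le> (\<integral>\<^sup>+\<omega>. ennreal \<bar>?u \<omega>\<bar> \<partial>M)"
        using integral_norm_bound_ennreal[OF int_u] by simp
      also have "\<dots> \<le> (\<integral>\<^sup>+\<omega>. ennreal L * m i * indicator {\<omega> \<in> space M. i < N \<omega>} \<omega> \<partial>M)"
        by (rule nn_integral_mono) (use b_near in auto)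
      also have "\<dots> = ennreal L * m i * ennreal (tail i)"
        by (simp add: nn_integral_cmult_indicator emeasure_eq_measure tail_def)
      finally show ?thesis .
    qed
    then have "ennreal (tail i) * ennreal \<bar>var i * g - bi i\<bar> \<le> ennreal (tail i) * (ennreal L * m i * ennreal (tail i))"
      by (rule mult_left_mono) simp
    also have "\<dots> = ennreal L * (m i * ennreal ((tail i)\<^sup>2))"
      by (simp add: power2_eq_square ennreal_mult tail_bounds mult_ac)
    finally show ?thesis
      using le by (meson add_right_mono order_trans)
  qed
  have "ennreal \<bar>v2 * expectation (\<lambda>\<omega>. f' (W \<omega>)) - expectation (\<lambda>\<omega>. W \<omega> * f (W \<omega>))\<bar> \<le> (\<Sum>i. ennreal \<bar>d i\<bar>)"
  \<comment> \<open>If the series of |d i| diverges, it is infinite as an extended real and the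
    bound is trivial.\<close>
  proof (cases "(\<Sum>i. ennreal \<bar>d i\<bar>) = top")
    case False
    then have summ: "summable (\<lambda>i. \<bar>d i\<bar>)"
      by (intro summable_suminf_not_top) auto
    have "\<bar>\<Sum>i. d i\<bar> \<le> (\<Sum>i. \<bar>d i\<bar>)" by (rule summable_rabs[OF summ])
    then have "ennreal \<bar>\<Sum>i. d i\<bar> \<le> ennreal (\<Sum>i. \<bar>d i\<bar>)" by (rule ennreal_leI)
    also have "\<dots> = (\<Sum>i. ennreal \<bar>d i\<bar>)" by (rule suminf_ennreal2[symmetric]) (use summ in auto)
    finally show ?thesis
      unfolding Ec Eb using sums_unique[OF d_sums] by simp
  qed simp
  also have "\<dots> \<le> (\<Sum>i. ennreal L * (m i * ennreal ((tail i)\<^sup>2)) + 2 * ennreal B * ennreal (var i * tail i * (1 - tail i)))"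
    by (intro suminf_le d_bound summableI)
  also have "\<dots> = (\<Sum>i. ennreal L * (m i * ennreal ((tail i)\<^sup>2))) + (\<Sum>i. 2 * ennreal B * ennreal (var i * tail i * (1 - tail i)))"
    by (rule suminf_add[symmetric]) (rule summableI)+
  also have "\<dots> = ennreal L * (\<Sum>i. m i * ennreal ((tail i)\<^sup>2)) + 2 * ennreal B * (\<Sum>i. ennreal (var i * tail i * (1 - tail i)))"
    by simp
  finally show ?thesis
    by (simp only: m_def v2_def)
qed

end

section \<open>The bound\<close>

theorem theorem2p4:
  fixes M :: "'a measure"
    and X :: "nat \<Rightarrow> 'a \<Rightarrow> real"
    and N I :: "'a \<Rightarrow> nat"
    and s :: "nat \<Rightarrow> real"
    and \<sigma> :: real
    and h f :: "real \<Rightarrow> real"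
  assumes M: "prob_space M"
    and X_indep: "prob_space.indep_vars M (\<lambda>_. borel) X {1..}"
    and X_square_integrable: "\<And>i. 1 \<le> i \<Longrightarrow> integrable M (\<lambda>\<omega>. (X i \<omega>)\<^sup>2)"
    and X_mean: "\<And>i. 1 \<le> i \<Longrightarrow> prob_space.expectation M (X i) = 0"
    and X_var: "\<And>i. 1 \<le> i \<Longrightarrow> prob_space.variance M (X i) = (s i)\<^sup>2"
    and N_indep: "prob_space.indep_rv M (count_space UNIV) N
          (\<Pi>\<^sub>M i\<in>{1..}. borel) (\<lambda>\<omega>. \<lambda>i\<in>{1..}. X i \<omega>)"
    and W_square_integrable: "integrable M (\<lambda>\<omega>. (random_sum X N \<omega>)\<^sup>2)"
    and \<sigma>_pos: "0 < \<sigma>"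
    and \<sigma>_var: "\<sigma>\<^sup>2 = prob_space.variance M (random_sum X N)"
    and I_indep: "prob_space.indep_rv M (count_space UNIV) I
          (count_space UNIV \<Otimes>\<^sub>M (\<Pi>\<^sub>M i\<in>{1..}. borel)) (\<lambda>\<omega>. (N \<omega>, \<lambda>i\<in>{1..}. X i \<omega>))"
    and I_range: "\<And>\<omega>. \<omega> \<in> space M \<Longrightarrow> 1 \<le> I \<omega>"
    and I_dist: "\<And>i. 1 \<le> i \<Longrightarrow>
          \<P>(\<omega> in M. I \<omega> = i) = (s i)\<^sup>2 * \<P>(\<omega> in M. i \<le> N \<omega>) / \<sigma>\<^sup>2"
    and h_lipschitz: "\<And>x y. \<bar>h y - h x\<bar> \<le> \<bar>y - x\<bar>"
    and f_solution: "bounded_stein_solution h f"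
  shows "(\<lambda>i. (s (Suc i))\<^sup>2 * \<P>(\<omega> in M. Suc i \<le> N \<omega>)) sums \<sigma>\<^sup>2 \<and>
    ennreal \<bar>prob_space.expectation M (\<lambda>\<omega>. h (random_sum X N \<omega> / \<sigma>)) - normal_mean h\<bar>
      \<le> ess_sup_norm (deriv (deriv f)) / ennreal (\<sigma> ^ 3) *
          (\<Sum>i. (ennreal (1 / 2) * abs_moment M 3 (X (Suc i))
                 + ennreal ((s (Suc i))\<^sup>2) * abs_moment M 1 (X (Suc i)))
                * ennreal (\<P>(\<omega> in M. Suc i \<le> N \<omega>)\<^sup>2))
        + 2 * sup_norm (deriv f) * ennreal (\<P>(\<omega> in M. N \<omega> < I \<omega>))"
proof -

  \<comment> \<open>Renumbering the summands from 0\<close>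
  interpret prob_space M by (rule M)
  define X' where "X' i = X (Suc i)" for i
  have W_eq: "random_sum X N = (\<lambda>\<omega>. \<Sum>i<N \<omega>. X' i \<omega>)"
    by (simp add: random_sum_def X'_def fun_eq_iff sum.atLeast1_atMost_eq)
  interpret R: centered_random_sum M X' N
  proof
    have "indep_vars (\<lambda>_. borel) X (Suc ` UNIV)"
      using X_indep by (rule indep_vars_subset) auto
    then show "indep_vars (\<lambda>_. borel) X' UNIV"
      using indep_vars_reindex[of Suc UNIV "\<lambda>_. borel" X] by (simp add: X'_def[abs_def])
    show "integrable M (\<lambda>\<omega>. (X' i \<omega>)\<^sup>2)" "expectation (X' i) = 0" for i
      using X_square_integrable X_mean by (simp_all add: X'_def)
    show "integrable M (\<lambda>\<omega>. (\<Sum>i<N \<omega>. X' i \<omega>)\<^sup>2)"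
      using W_square_integrable by (simp add: W_eq)
    \<comment> \<open>The shift of coordinates is a measurable map between the product spaces, so it
      preserves independence from \<open>N\<close>.\<close>
    have "(\<lambda>x i. x (Suc i)) \<in> (\<Pi>\<^sub>M i\<in>{1..}. borel) \<rightarrow>\<^sub>M (\<Pi>\<^sub>M i\<in>UNIV. borel :: real measure)"
    proof (rule measurable_PiM_single')
      show "(\<lambda>x. x (Suc i)) \<in> (\<Pi>\<^sub>M i\<in>{1..}. borel) \<rightarrow>\<^sub>M (borel :: real measure)" for i
        by (rule measurable_component_singleton) simp
    qed auto
    from indep_rv_compose[OF N_indep measurable_ident this]
    show "indep_rv (count_space UNIV) N (\<Pi>\<^sub>M i\<in>UNIV. borel) (\<lambda>\<omega> i. X' i \<omega>)"
      by (simp add: X'_def)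
  qed
  let ?W = "random_sum X N"
  have W_S: "?W = (\<lambda>\<omega>. R.S (N \<omega>) \<omega>)"
    by (simp add: W_eq R.S_def)
  have W_meas[measurable]: "?W \<in> borel_measurable M"
    unfolding W_S by measurable
  have W_int: "integrable M ?W"
    unfolding W_S by (rule R.random_sum_integrable)
  have \<sigma>2: "\<sigma>\<^sup>2 = expectation (\<lambda>\<omega>. (?W \<omega>)\<^sup>2)"
    using \<sigma>_var R.random_sum_mean by (simp add: W_S)
  have var: "R.var i = (s (Suc i))\<^sup>2" for i
    using X_var[of "Suc i"] X_mean[of "Suc i"] by (simp add: R.var_def X'_def)
  have tail: "R.tail i = \<P>(\<omega> in M. Suc i \<le> N \<omega>)" for i
    by (simp add: R.tail_def Suc_le_eq)
  have var_sums: "(\<lambda>i. (s (Suc i))\<^sup>2 * \<P>(\<omega> in M. Suc i \<le> N \<omega>)) sums \<sigma>\<^sup>2"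
    using R.random_sum_variance_sums unfolding var tail \<sigma>2 W_S .
  define A where "A = (\<Sum>i. (ennreal (1 / 2) * abs_moment M 3 (X (Suc i))
                 + ennreal ((s (Suc i))\<^sup>2) * abs_moment M 1 (X (Suc i)))
                * ennreal (\<P>(\<omega> in M. Suc i \<le> N \<omega>)\<^sup>2))"
  define Q where "Q = \<P>(\<omega> in M. N \<omega> < I \<omega>)"
  have Q_sums: "(\<lambda>i. R.var i * R.tail i * (1 - R.tail i)) sums (\<sigma>\<^sup>2 * Q)"
  proof -
    have [measurable]: "I \<in> M \<rightarrow>\<^sub>M count_space UNIV"
      by (rule indep_rv_measurable(1)[OF I_indep])
    have IN: "indep_rv (count_space UNIV) I (count_space UNIV) N"
      using indep_rv_compose[OF I_indep measurable_ident measurable_fst] by simp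
    let ?E = "\<lambda>i. {\<omega> \<in> space M. I \<omega> = Suc i \<and> N \<omega> < Suc i}"
    have "(\<lambda>i. prob (?E i)) sums prob (\<Union>i. ?E i)"
      by (rule finite_measure_UNION) (auto simp: disjoint_family_on_def)
    also have "(\<Union>i. ?E i) = {\<omega> \<in> space M. N \<omega> < I \<omega>}"
    proof (intro equalityI subsetI)
      fix \<omega> assume "\<omega> \<in> {\<omega> \<in> space M. N \<omega> < I \<omega>}"
      then show "\<omega> \<in> (\<Union>i. ?E i)"
        using I_range[of \<omega>] by (intro UN_I[of "I \<omega> - 1"]) auto
    qed auto
    finally have "(\<lambda>i. prob (?E i)) sums Q" by (simp add: Q_def)
    moreover have "prob (?E i) = R.var i * R.tail i * (1 - R.tail i) / \<sigma>\<^sup>2" for i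
    proof -
      have "prob (?E i) = \<P>(\<omega> in M. I \<omega> = Suc i) * \<P>(\<omega> in M. N \<omega> < Suc i)"
        using indep_rv_prob[OF IN, of "{Suc i}" "{..<Suc i}"] by simp
      also have "\<P>(\<omega> in M. N \<omega> < Suc i) = 1 - R.tail i"
        using prob_neg[of "\<lambda>\<omega>. i < N \<omega>"] by (simp add: R.tail_def not_less less_Suc_eq_le)
      also have "\<P>(\<omega> in M. I \<omega> = Suc i) = R.var i * R.tail i / \<sigma>\<^sup>2"
        using I_dist[of "Suc i"] by (simp add: var tail)
      finally show ?thesis by simp
    qed
    ultimately have "(\<lambda>i. \<sigma>\<^sup>2 * (R.var i * R.tail i * (1 - R.tail i) / \<sigma>\<^sup>2)) sums (\<sigma>\<^sup>2 * Q)"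
      by (intro sums_mult) simp
    then show ?thesis using \<sigma>_pos by simp
  qed
  have Q0: "0 \<le> Q" by (simp add: Q_def)
  have Q_suminf: "(\<Sum>i. ennreal (R.var i * R.tail i * (1 - R.tail i))) = ennreal (\<sigma>\<^sup>2 * Q)"
    by (rule suminf_ennreal_eq[OF _ Q_sums]) (simp add: R.var_nonneg R.tail_bounds)
  have bound: "ennreal \<bar>expectation (\<lambda>\<omega>. h (?W \<omega> / \<sigma>)) - normal_mean h\<bar>
      \<le> ess_sup_norm (deriv (deriv f)) / ennreal (\<sigma> ^ 3) * A + 2 * sup_norm (deriv f) * ennreal Q"
  proof (cases "ess_sup_norm (deriv (deriv f)) = top")
    case True
    have "A \<noteq> 0"
    proof
      assume "A = 0"
      then have zero: "(ennreal (1 / 2) * abs_moment M 3 (X (Suc i))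
                 + ennreal ((s (Suc i))\<^sup>2) * abs_moment M 1 (X (Suc i)))
                * ennreal (\<P>(\<omega> in M. Suc i \<le> N \<omega>)\<^sup>2) = 0" for i
        unfolding A_def by (subst (asm) suminf_eq_zero_iff) (simp_all add: summableI)
      have "R.var i * R.tail i = 0" for i
      proof (rule ccontr)
        assume nz: "R.var i * R.tail i \<noteq> 0"
        then have "abs_moment M 1 (X (Suc i)) = 0"
          using zero[of i] R.var_nonneg[of i] R.tail_bounds(1)[of i]
          unfolding var[symmetric] tail[symmetric] by (auto simp: ennreal_eq_0_iff)
        then have "AE \<omega> in M. ennreal (\<bar>X' i \<omega>\<bar> ^ 1) = 0"
          unfolding abs_moment_def X'_def[symmetric] by (subst (asm) nn_integral_0_iff_AE) auto
        then have "AE \<omega> in M. (X' i \<omega>)\<^sup>2 = 0" by eventually_elim simp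
        then have "R.var i = expectation (\<lambda>\<omega>. 0)"
          unfolding R.var_def by (intro integral_cong_AE) auto
        with nz show False by simp
      qed
      then have "(\<lambda>_::nat. 0::real) sums \<sigma>\<^sup>2"
        using var_sums unfolding var[symmetric] tail[symmetric] by (simp only:)
      then have "\<sigma>\<^sup>2 = 0" by (rule sums_unique2[OF _ sums_zero])
      then show False using \<sigma>_pos by simp
    qed
    then show ?thesis
      using True \<sigma>_pos by (simp add: ennreal_top_divide ennreal_top_mult)
  next
    case False
    then obtain L where L: "0 \<le> L" "ess_sup_norm (deriv (deriv f)) = ennreal L"
      by (cases "ess_sup_norm (deriv (deriv f))") auto
    obtain F where F: "\<And>w. \<bar>f w\<bar> \<le> F" and f': "\<And>w. (f has_real_derivative deriv f w) (at w)"
      and stein: "\<And>w. deriv f w = w * f w + h w - normal_mean h"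
      using bounded_stein_solutionE[OF f_solution] by metis
    have lip: "\<bar>deriv f x - deriv f y\<bar> \<le> L * \<bar>x - y\<bar>" for x y
      by (rule stein_solution_deriv_lipschitz[OF h_lipschitz f_solution L])
    have "sup_norm (deriv f) \<le> ennreal (2 * F + L)"
      unfolding sup_norm_def
      by (intro SUP_least ennreal_leI bounded_lipschitz_deriv_imp_bounded_deriv[OF F f' lip])
    then obtain B where B: "0 \<le> B" "sup_norm (deriv f) = ennreal B"
      by (cases "sup_norm (deriv f)") (auto simp: top_unique)
    have B_bound: "\<bar>deriv f w\<bar> \<le> B" for w
    proof -
      have "ennreal \<bar>deriv f w\<bar> \<le> ennreal B"
        unfolding B(2)[symmetric] sup_norm_def by (rule SUP_upper) simp
      then show ?thesis using B(1) by (simp add: ennreal_le_iff)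
    qed
    define g where "g w = f (w / \<sigma>)" for w
    define g' where "g' w = deriv f (w / \<sigma>) / \<sigma>" for w
    have g_deriv: "(g has_real_derivative g' w) (at w)" for w
    proof -
      have "((\<lambda>w. w / \<sigma>) has_real_derivative 1 / \<sigma>) (at w)"
        by (intro DERIV_cdivide DERIV_ident)
      from DERIV_chain'[OF this f'] show ?thesis
        unfolding g_def g'_def by simp
    qed
    have g'_lip: "\<bar>g' x - g' y\<bar> \<le> L / \<sigma>\<^sup>2 * \<bar>x - y\<bar>" for x y
    proof -
      have "\<bar>g' x - g' y\<bar> = \<bar>deriv f (x / \<sigma>) - deriv f (y / \<sigma>)\<bar> / \<sigma>"
        using \<sigma>_pos by (simp add: g'_def diff_divide_distrib[symmetric])
      also have "\<dots> \<le> (L * \<bar>x / \<sigma> - y / \<sigma>\<bar>) / \<sigma>"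
        using \<sigma>_pos by (intro divide_right_mono lip) simp
      also have "\<dots> = L / \<sigma>\<^sup>2 * \<bar>x - y\<bar>"
        using \<sigma>_pos by (simp add: diff_divide_distrib[symmetric] power2_eq_square)
      finally show ?thesis .
    qed
    have g'_bound: "\<bar>g' w\<bar> \<le> B / \<sigma>" for w
      using B_bound \<sigma>_pos by (simp add: g'_def divide_right_mono)
    let ?D = "\<sigma>\<^sup>2 * expectation (\<lambda>\<omega>. g' (?W \<omega>)) - expectation (\<lambda>\<omega>. ?W \<omega> * g (?W \<omega>))"
    have g_bound: "\<bar>g w\<bar> \<le> F" for w
      using F by (simp add: g_def)
    have L': "0 \<le> L / \<sigma>\<^sup>2"
      using L(1) by simp
    have A_eq: "(\<Sum>i. (ennreal (1 / 2) * abs_moment M 3 (X' i) + ennreal (R.var i) * abs_moment M 1 (X' i))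
        * ennreal ((R.tail i)\<^sup>2)) = A"
      by (simp only: A_def var tail X'_def)
    have W2_eq: "expectation (\<lambda>\<omega>. (R.S (N \<omega>) \<omega>)\<^sup>2) = \<sigma>\<^sup>2"
      by (simp only: \<sigma>2 W_S)
    have D_bound: "ennreal \<bar>?D\<bar> \<le> ennreal (L / \<sigma>\<^sup>2) * A + 2 * ennreal (B / \<sigma>) * ennreal (\<sigma>\<^sup>2 * Q)"
      using R.stein_random_sum_bound[OF g_bound g_deriv L' g'_lip g'_bound]
      by (simp only: W_S W2_eq A_eq Q_suminf)
    \<comment> \<open>Stein's equation evaluated at W / \<sigma>; since g' carries a factor 1 /
      \<sigma>, both terms of \<open>?D\<close> are \<sigma> times the corresponding terms of the
      equation.\<close>
    have "expectation (\<lambda>\<omega>. h (?W \<omega> / \<sigma>)) - normal_mean h = 1 / \<sigma> * ?D"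
    proof -
      have "continuous_on UNIV f"
        using f' DERIV_isCont by (blast intro: continuous_at_imp_continuous_on)
      then have f_meas[measurable]: "f \<in> borel_measurable borel"
        by (rule borel_measurable_continuous_onI)
      have "L-lipschitz_on UNIV (deriv f)"
        using L(1) lip by (intro lipschitz_onI) (auto simp: dist_real_def)
      then have f'_meas[measurable]: "deriv f \<in> borel_measurable borel"
        by (intro borel_measurable_continuous_onI lipschitz_on_continuous_on)
      have int1: "integrable M (\<lambda>\<omega>. deriv f (?W \<omega> / \<sigma>))"
        by (rule integrable_const_bound[where B = B]) (use B_bound in auto)
      have int2: "integrable M (\<lambda>\<omega>. ?W \<omega> * f (?W \<omega> / \<sigma>))"
      proof (rule Bochner_Integration.integrable_bound)
        show "integrable M (\<lambda>\<omega>. F * ?W \<omega>)" using W_int by simp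
        have "\<bar>?W \<omega> * f (?W \<omega> / \<sigma>)\<bar> \<le> \<bar>F * ?W \<omega>\<bar>" for \<omega>
          using mult_left_mono[OF F, of "\<bar>?W \<omega>\<bar>" "?W \<omega> / \<sigma>"] order_trans[OF abs_ge_zero F]
          by (simp add: abs_mult mult.commute)
        then show "AE \<omega> in M. norm (?W \<omega> * f (?W \<omega> / \<sigma>)) \<le> norm (F * ?W \<omega>)" by simp
      qed measurable
      have "(\<lambda>\<omega>. h (?W \<omega> / \<sigma>)) = (\<lambda>\<omega>. deriv f (?W \<omega> / \<sigma>) - 1 / \<sigma> * (?W \<omega> * f (?W \<omega> / \<sigma>)) + normal_mean h)"
        by (simp add: stein fun_eq_iff)
      then have "expectation (\<lambda>\<omega>. h (?W \<omega> / \<sigma>)) = expectation (\<lambda>\<omega>. deriv f (?W \<omega> / \<sigma>))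
          - 1 / \<sigma> * expectation (\<lambda>\<omega>. ?W \<omega> * f (?W \<omega> / \<sigma>)) + normal_mean h"
        using int1 int2 by (simp add: prob_space)
      then show ?thesis
        using \<sigma>_pos by (simp add: g_def g'_def right_diff_distrib power2_eq_square)
    qed
    then have "ennreal \<bar>expectation (\<lambda>\<omega>. h (?W \<omega> / \<sigma>)) - normal_mean h\<bar> = ennreal (1 / \<sigma>) * ennreal \<bar>?D\<bar>"
      using \<sigma>_pos by (simp only: abs_mult) (subst ennreal_mult[symmetric], auto)
    also have "\<dots> \<le> ennreal (1 / \<sigma>) * (ennreal (L / \<sigma>\<^sup>2) * A + 2 * ennreal (B / \<sigma>) * ennreal (\<sigma>\<^sup>2 * Q))"
      by (rule mult_left_mono[OF D_bound]) simp
    also have "\<dots> = (ennreal (1 / \<sigma>) * ennreal (L / \<sigma>\<^sup>2)) * A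
        + 2 * (ennreal (1 / \<sigma>) * ennreal (B / \<sigma>) * ennreal (\<sigma>\<^sup>2 * Q))"
      by (simp only: distrib_left mult_ac)
    also have "ennreal (1 / \<sigma>) * ennreal (L / \<sigma>\<^sup>2) = ennreal L / ennreal (\<sigma> ^ 3)"
      using \<sigma>_pos L(1)
      by (simp add: divide_ennreal ennreal_mult[symmetric] power2_eq_square power3_eq_cube mult.assoc)
    also have "ennreal (1 / \<sigma>) * ennreal (B / \<sigma>) * ennreal (\<sigma>\<^sup>2 * Q) = ennreal B * ennreal Q"
      using \<sigma>_pos B(1) Q0 by (simp add: ennreal_mult[symmetric] power2_eq_square)
    finally show ?thesis
      by (simp only: L(2) B(2) mult.assoc)
  qed
  show ?thesis
    using var_sums bound unfolding A_def Q_def by blast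
qed

end
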